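(* One has the following. (1) If $f: Q \to Q'$ is a morphism of precoherent prequantales, then the map $\mathsf{K}(f): \mathsf{K}(Q) \to \mathsf{K}(Q')$ given by $\mathsf{K}(f)(x) = f(x)$ for all $x \in \mathsf{K}(Q)$ is a morphism of prequantic semilattices. (2) If $g: M \to M'$ is a morphism of prequantic semilattices, then the map $\mathsf{Idl}(g): \mathsf{Idl}(M) \to \mathsf{Idl}(M')$ given by $\mathsf{Idl}(g)(I) =\ \downarrow\!(g(I))$ for all $I \in \mathsf{Idl}(M)$ is a morphism of precoherent prequantales. (3) The associations $\mathsf{K}$ and $\mathsf{Idl}$ are functorial and provide an equivalence of categories between the category of precoherent prequantales and the category of prequantic semilattices.
   Context: An ordered magma is a set with a binary operation (written multiplicatively) and a partial order such that $x\le x'$, $y \le y'$ imply $xy \le x'y'$. A prequantale is an ordered magma $Q$ such that $\bigvee X$ exists and $a(\bigvee X) = \bigvee(aX)$, $(\bigvee X)a = \bigvee(Xa)$ for every $a \in Q$ and every $X\subseteq Q$. A prequantic semilattice is an ordered magma $M$ that is a join semilattice with $a(x\vee y) = ax \vee ay$ and $(x\vee y)a = xa\vee ya$ for all $a,x,y\in M$, and that has an annihilator, i.e. a least element $0$ with $0x=0=x0$ for all $x\in M$; a morphism of prequantic semilattices is a magma homomorphism $f$ with $f(\bigvee X)=\bigvee f(X)$ for all finite subsets $X$ (including $X = \emptyset$). A directed subset of a poset is a nonempty subset $\Delta$ in which every finite subset has an upper bound in $\Delta$. An element $x$ of a poset $S$ is compact if, whenever $x \le \bigvee\Delta$ for a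 directed $\Delta\subseteq S$ for which $\bigvee\Delta$ exists, one has $x \le y$ for some $y \in \Delta$; $\mathsf{K}(S)$ is the set of compact elements of $S$ (with the induced order and, when $S$ is an ordered magma with $\mathsf{K}(S)$ closed under multiplication, the induced multiplication). An ordered magma $M$ is precoherent if every element of $M$ is the supremum of a set of compact elements and $\mathsf{K}(M)$ is closed under multiplication. A morphism of prequantales is a magma homomorphism $f$ with $f(\bigvee X) = \bigvee f(X)$ for all subsets $X$; a morphism $f:Q\to Q'$ of precoherent prequantales is such a map with $Q,Q'$ precoherent and $f(\mathsf{K}(Q)) \subseteq \mathsf{K}(Q')$. An ideal of a poset $S$ is a directed downward closed subset of $S$; $\mathsf{Idl}(S)$ is the set of ideals of $S$ ordered by inclusion. For a join semilattice $S$ and nonempty $X\subseteq S$, $\downarrow\! X = \{y\in S: y\le \bigvee T \text{ for some finite nonempty } T\subseteq X\}$. For a prequantic semilattice $M$, $\mathsf{Idl}(M)$ is regarded as an ordered magma under $\downarrow$-multiplication $(I,J)\mapsto\ \downarrow\!(IJ)$, where $IJ=\{xy: x\in I,y\in J\}$; it is a precoherent prequantale. *)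

theory Defs
  imports "HOL-Algebra.Lattice" "HOL-Library.FuncSet"
begin

section \<open>Ordered magmas\<close>

record 'a omagma = "'a gorder" +
  mul :: "['a, 'a] \<Rightarrow> 'a" (infixl "\<cdot>\<index>" 70)

text \<open>Suprema are those of HOL-Algebra: \<open>least S s (Upper S X)\<close> says that the supremum of \<open>X\<close>
  in \<open>S\<close> exists and is \<open>s\<close>; \<open>\<Squnion>\<^bsub>S\<^esub> X\<close> is that element when it exists. For \<open>X = {}\<close> it is the least
  element of \<open>S\<close>.\<close>

locale ordered_magma = partial_order M for M :: "'a omagma" (structure) +
  assumes mul_closed: "\<lbrakk>x \<in> carrier M; y \<in> carrier M\<rbrakk> \<Longrightarrow> x \<cdot> y \<in> carrier M"
    and mul_mono:
      "\<lbrakk>x \<in> carrier M; x' \<in> carrier M; y \<in> carrier M; y' \<in> carrier M; x \<sqsubseteq> x'; y \<sqsubseteq> y'\<rbrakk>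
        \<Longrightarrow> x \<cdot> y \<sqsubseteq> x' \<cdot> y'"

locale prequantale = ordered_magma Q for Q :: "'a omagma" (structure) +
  assumes sup_exists: "X \<subseteq> carrier Q \<Longrightarrow> \<exists>s. least Q s (Upper Q X)"
    and mul_sup: "\<lbrakk>a \<in> carrier Q; X \<subseteq> carrier Q\<rbrakk> \<Longrightarrow> a \<cdot> (\<Squnion> X) = \<Squnion> ((\<lambda>x. a \<cdot> x) ` X)"
    and sup_mul: "\<lbrakk>a \<in> carrier Q; X \<subseteq> carrier Q\<rbrakk> \<Longrightarrow> (\<Squnion> X) \<cdot> a = \<Squnion> ((\<lambda>x. x \<cdot> a) ` X)"

locale prequantic_semilattice = ordered_magma M + upper_semilattice M
  for M :: "'a omagma" (structure) +
  assumes mul_join: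
      "\<lbrakk>a \<in> carrier M; x \<in> carrier M; y \<in> carrier M\<rbrakk> \<Longrightarrow> a \<cdot> (x \<squnion> y) = (a \<cdot> x) \<squnion> (a \<cdot> y)"
    and join_mul:
      "\<lbrakk>a \<in> carrier M; x \<in> carrier M; y \<in> carrier M\<rbrakk> \<Longrightarrow> (x \<squnion> y) \<cdot> a = (x \<cdot> a) \<squnion> (y \<cdot> a)"
    and annihilator:
      "\<exists>z. least M z (carrier M) \<and> (\<forall>x\<in>carrier M. z \<cdot> x = z \<and> x \<cdot> z = z)"

definition magma_hom :: "'a omagma \<Rightarrow> 'b omagma \<Rightarrow> ('a \<Rightarrow> 'b) \<Rightarrow> bool" where
  "magma_hom M M' f \<longleftrightarrow> f \<in> carrier M \<rightarrow> carrier M' \<and>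
     (\<forall>x\<in>carrier M. \<forall>y\<in>carrier M. f (x \<cdot>\<^bsub>M\<^esub> y) = f x \<cdot>\<^bsub>M'\<^esub> f y)"

definition prequantic_semilattice_morphism ::
  "'a omagma \<Rightarrow> 'b omagma \<Rightarrow> ('a \<Rightarrow> 'b) \<Rightarrow> bool" where
  "prequantic_semilattice_morphism M M' f \<longleftrightarrow>
     prequantic_semilattice M \<and> prequantic_semilattice M' \<and> magma_hom M M' f \<and>
     (\<forall>X. finite X \<and> X \<subseteq> carrier M \<longrightarrow> f (\<Squnion>\<^bsub>M\<^esub> X) = \<Squnion>\<^bsub>M'\<^esub> (f ` X))"

definition prequantale_morphism :: "'a omagma \<Rightarrow> 'b omagma \<Rightarrow> ('a \<Rightarrow> 'b) \<Rightarrow> bool" where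
  "prequantale_morphism Q Q' f \<longleftrightarrow>
     prequantale Q \<and> prequantale Q' \<and> magma_hom Q Q' f \<and>
     (\<forall>X. X \<subseteq> carrier Q \<longrightarrow> f (\<Squnion>\<^bsub>Q\<^esub> X) = \<Squnion>\<^bsub>Q'\<^esub> (f ` X))"

section \<open>Compact elements\<close>

definition directed_in :: "('a, 'r) gorder_scheme \<Rightarrow> 'a set \<Rightarrow> bool" where
  "directed_in S D \<longleftrightarrow> D \<subseteq> carrier S \<and> D \<noteq> {} \<and>
     (\<forall>F. finite F \<and> F \<subseteq> D \<longrightarrow> (\<exists>u\<in>D. \<forall>x\<in>F. x \<sqsubseteq>\<^bsub>S\<^esub> u))"

definition compact_elements :: "('a, 'r) gorder_scheme \<Rightarrow> 'a set" where
  "compact_elements S = {x \<in> carrier S.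
     \<forall>D s. directed_in S D \<and> least S s (Upper S D) \<and> x \<sqsubseteq>\<^bsub>S\<^esub> s \<longrightarrow> (\<exists>y\<in>D. x \<sqsubseteq>\<^bsub>S\<^esub> y)}"

definition K :: "'a omagma \<Rightarrow> 'a omagma" where
  "K M = M\<lparr>carrier := compact_elements M\<rparr>"

definition precoherent :: "'a omagma \<Rightarrow> bool" where
  "precoherent M \<longleftrightarrow> ordered_magma M \<and>
     (\<forall>x\<in>carrier M. \<exists>X. X \<subseteq> compact_elements M \<and> least M x (Upper M X)) \<and>
     (\<forall>x\<in>compact_elements M. \<forall>y\<in>compact_elements M. x \<cdot>\<^bsub>M\<^esub> y \<in> compact_elements M)"

definition precoherent_prequantale :: "'a omagma \<Rightarrow> bool" where
  "precoherent_prequantale Q \<longleftrightarrow> prequantale Q \<and> precoherent Q"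

definition precoherent_prequantale_morphism ::
  "'a omagma \<Rightarrow> 'b omagma \<Rightarrow> ('a \<Rightarrow> 'b) \<Rightarrow> bool" where
  "precoherent_prequantale_morphism Q Q' f \<longleftrightarrow>
     precoherent_prequantale Q \<and> precoherent_prequantale Q' \<and> prequantale_morphism Q Q' f \<and>
     f ` compact_elements Q \<subseteq> compact_elements Q'"

definition K_map :: "'a omagma \<Rightarrow> ('a \<Rightarrow> 'b) \<Rightarrow> 'a \<Rightarrow> 'b" where
  "K_map Q f = (\<lambda>x\<in>carrier (K Q). f x)"

section \<open>Ideals\<close>

definition ideals :: "('a, 'r) gorder_scheme \<Rightarrow> 'a set set" where
  "ideals S = {I. directed_in S I \<and> (\<forall>x\<in>I. \<forall>y\<in>carrier S. y \<sqsubseteq>\<^bsub>S\<^esub> x \<longrightarrow> y \<in> I)}"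

definition down :: "('a, 'r) gorder_scheme \<Rightarrow> 'a set \<Rightarrow> 'a set" where
  "down S X = {y \<in> carrier S. \<exists>T. finite T \<and> T \<noteq> {} \<and> T \<subseteq> X \<and> y \<sqsubseteq>\<^bsub>S\<^esub> \<Squnion>\<^bsub>S\<^esub> T}"

definition Idl :: "'a omagma \<Rightarrow> 'a set omagma" where
  "Idl M = \<lparr>carrier = ideals M, eq = (=), le = (\<subseteq>),
            mul = (\<lambda>I J. down M {x \<cdot>\<^bsub>M\<^esub> y | x y. x \<in> I \<and> y \<in> J})\<rparr>"

definition Idl_map :: "'a omagma \<Rightarrow> 'b omagma \<Rightarrow> ('a \<Rightarrow> 'b) \<Rightarrow> 'a set \<Rightarrow> 'b set" where
  "Idl_map M M' g = (\<lambda>I\<in>carrier (Idl M). down M' (g ` I))"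

section \<open>Isomorphisms between structures over different types\<close>

definition prequantic_semilattice_iso :: "'a omagma \<Rightarrow> 'b omagma \<Rightarrow> ('a \<Rightarrow> 'b) \<Rightarrow> bool" where
  "prequantic_semilattice_iso M M' f \<longleftrightarrow> prequantic_semilattice_morphism M M' f \<and>
     (\<exists>g. prequantic_semilattice_morphism M' M g \<and>
          (\<forall>x\<in>carrier M. g (f x) = x) \<and> (\<forall>y\<in>carrier M'. f (g y) = y))"

definition precoherent_prequantale_iso :: "'a omagma \<Rightarrow> 'b omagma \<Rightarrow> ('a \<Rightarrow> 'b) \<Rightarrow> bool" where
  "precoherent_prequantale_iso Q Q' f \<longleftrightarrow> precoherent_prequantale_morphism Q Q' f \<and>
     (\<exists>g. precoherent_prequantale_morphism Q' Q g \<and>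
          (\<forall>x\<in>carrier Q. g (f x) = x) \<and> (\<forall>y\<in>carrier Q'. f (g y) = y))"

definition Idl_K_unit :: "'a omagma \<Rightarrow> 'a \<Rightarrow> 'a set" where
  "Idl_K_unit Q = (\<lambda>x\<in>carrier Q. {c \<in> compact_elements Q. c \<sqsubseteq>\<^bsub>Q\<^esub> x})"

definition K_Idl_unit :: "'a omagma \<Rightarrow> 'a \<Rightarrow> 'a set" where
  "K_Idl_unit M = (\<lambda>x\<in>carrier M. {y \<in> carrier M. y \<sqsubseteq>\<^bsub>M\<^esub> x})"

section \<open>Categories\<close>

text \<open>\<open>cmp C g f\<close> is the composite of \<open>g\<close> after \<open>f\<close>.\<close>

record ('o, 'm) cat =
  obj :: "'o set"
  arr :: "'m set"
  src :: "'m \<Rightarrow> 'o"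
  tgt :: "'m \<Rightarrow> 'o"
  ide :: "'o \<Rightarrow> 'm"
  cmp :: "'m \<Rightarrow> 'm \<Rightarrow> 'm"

locale category =
  fixes C :: "('o, 'm) cat"
  assumes src_obj: "f \<in> arr C \<Longrightarrow> src C f \<in> obj C"
    and tgt_obj: "f \<in> arr C \<Longrightarrow> tgt C f \<in> obj C"
    and ide_arr: "A \<in> obj C \<Longrightarrow> ide C A \<in> arr C \<and> src C (ide C A) = A \<and> tgt C (ide C A) = A"
    and cmp_arr: "\<lbrakk>f \<in> arr C; g \<in> arr C; tgt C f = src C g\<rbrakk>
      \<Longrightarrow> cmp C g f \<in> arr C \<and> src C (cmp C g f) = src C f \<and> tgt C (cmp C g f) = tgt C g"
    and cmp_ide: "f \<in> arr C \<Longrightarrow> cmp C f (ide C (src C f)) = f \<and> cmp C (ide C (tgt C f)) f = f"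
    and cmp_assoc: "\<lbrakk>f \<in> arr C; g \<in> arr C; h \<in> arr C; tgt C f = src C g; tgt C g = src C h\<rbrakk>
      \<Longrightarrow> cmp C h (cmp C g f) = cmp C (cmp C h g) f"

definition iso_arr :: "('o, 'm) cat \<Rightarrow> 'm \<Rightarrow> bool" where
  "iso_arr C f \<longleftrightarrow> f \<in> arr C \<and>
     (\<exists>g\<in>arr C. src C g = tgt C f \<and> tgt C g = src C f \<and>
        cmp C g f = ide C (src C f) \<and> cmp C f g = ide C (tgt C f))"

locale cat_functor = C: category C + D: category D
  for C :: "('o, 'm) cat" and D :: "('p, 'n) cat" +
  fixes Fo :: "'o \<Rightarrow> 'p" and Fa :: "'m \<Rightarrow> 'n"
  assumes map_obj: "A \<in> obj C \<Longrightarrow> Fo A \<in> obj D"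
    and map_arr: "f \<in> arr C
      \<Longrightarrow> Fa f \<in> arr D \<and> src D (Fa f) = Fo (src C f) \<and> tgt D (Fa f) = Fo (tgt C f)"
    and map_ide: "A \<in> obj C \<Longrightarrow> Fa (ide C A) = ide D (Fo A)"
    and map_cmp: "\<lbrakk>f \<in> arr C; g \<in> arr C; tgt C f = src C g\<rbrakk>
      \<Longrightarrow> Fa (cmp C g f) = cmp D (Fa g) (Fa f)"

locale natural_iso = F: cat_functor C D Fo Fa + G: cat_functor C D Go Ga
  for C :: "('o, 'm) cat" and D :: "('p, 'n) cat" and Fo Fa Go Ga +
  fixes \<eta> :: "'o \<Rightarrow> 'n"
  assumes component: "A \<in> obj C
      \<Longrightarrow> iso_arr D (\<eta> A) \<and> src D (\<eta> A) = Fo A \<and> tgt D (\<eta> A) = Go A"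
    and naturality: "f \<in> arr C
      \<Longrightarrow> cmp D (\<eta> (tgt C f)) (Fa f) = cmp D (Ga f) (\<eta> (src C f))"

definition equivalence_of_categories ::
  "('o, 'm) cat \<Rightarrow> ('p, 'n) cat \<Rightarrow> ('o \<Rightarrow> 'p) \<Rightarrow> ('m \<Rightarrow> 'n) \<Rightarrow> ('p \<Rightarrow> 'o) \<Rightarrow> ('n \<Rightarrow> 'm) \<Rightarrow> bool"
  where
  "equivalence_of_categories C D Fo Fa Go Ga \<longleftrightarrow>
     cat_functor C D Fo Fa \<and> cat_functor D C Go Ga \<and>
     (\<exists>\<eta>. natural_iso C C (\<lambda>A. A) (\<lambda>f. f) (Go \<circ> Fo) (Ga \<circ> Fa) \<eta>) \<and>
     (\<exists>\<epsilon>. natural_iso D D (Fo \<circ> Go) (Fa \<circ> Ga) (\<lambda>A. A) (\<lambda>f. f) \<epsilon>)"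

section \<open>The two categories over a universe of sets\<close>

text \<open>An object of a category has to be a structure over one fixed type, whereas \<open>Idl\<close> raises \<open>'a\<close>
  to \<open>'a set\<close>. So the categories are formed over a type \<open>'u\<close> playing the role of a universe:
  \<open>small\<close> singles out sets of elements of \<open>'u\<close>, and \<open>enc A\<close> is the element of \<open>'u\<close> that represents
  the small set \<open>A\<close>. Closure under power sets is not required. Hence, besides Grothendieck
  universes, every infinite type \<open>'k\<close> gives an example: take \<open>'u = 'k set\<close> and let the small sets be
  those that inject into \<open>'k\<close>; there are only as many of them as elements of \<open>'u\<close>.\<close>

definition set_universe :: "('u set \<Rightarrow> bool) \<Rightarrow> ('u set \<Rightarrow> 'u) \<Rightarrow> bool" where
  "set_universe small enc \<longleftrightarrow> inj_on enc {A. small A} \<and>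
     (\<forall>A B. small A \<and> B \<subseteq> A \<longrightarrow> small B) \<and>
     (\<forall>A (h :: 'u \<Rightarrow> 'u). small A \<longrightarrow> small (h ` A))"

text \<open>An arrow is a map together with its domain and codomain; the map is extensional, i.e.
  \<open>undefined\<close> off the carrier, so that equal arrows are equal as HOL terms.\<close>

type_synonym 'u arrow = "'u omagma \<times> ('u \<Rightarrow> 'u) \<times> 'u omagma"

definition concrete_cat ::
  "('u omagma \<Rightarrow> bool) \<Rightarrow> ('u omagma \<Rightarrow> 'u omagma \<Rightarrow> ('u \<Rightarrow> 'u) \<Rightarrow> bool) \<Rightarrow> ('u omagma, 'u arrow) cat"
  where
  "concrete_cat ob hom =
     \<lparr>obj = {A. ob A},
      arr = {(A, f, B). ob A \<and> ob B \<and> hom A B f \<and> f \<in> extensional (carrier A)},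
      src = (\<lambda>(A, f, B). A),
      tgt = (\<lambda>(A, f, B). B),
      ide = (\<lambda>A. (A, \<lambda>x\<in>carrier A. x, A)),
      cmp = (\<lambda>(B', g, D) (A, f, B). (A, compose (carrier A) g f, D))\<rparr>"

text \<open>Every element of a precoherent prequantale is the supremum of the compact elements below it, so
  the size of \<open>Q\<close> is controlled by that of \<open>K Q\<close>. If the small sets are closed under power sets,
  then \<open>K Q\<close> is small exactly when \<open>Q\<close> is.\<close>

definition PrecoherentPrequantales :: "('u set \<Rightarrow> bool) \<Rightarrow> ('u omagma, 'u arrow) cat" where
  "PrecoherentPrequantales small =
     concrete_cat (\<lambda>Q. precoherent_prequantale Q \<and> small (carrier (K Q)))
       precoherent_prequantale_morphism"

definition PrequanticSemilattices :: "('u set \<Rightarrow> bool) \<Rightarrow> ('u omagma, 'u arrow) cat" where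
  "PrequanticSemilattices small =
     concrete_cat (\<lambda>M. prequantic_semilattice M \<and> small (carrier M))
       prequantic_semilattice_morphism"

definition K_arr :: "'u arrow \<Rightarrow> 'u arrow" where
  "K_arr = (\<lambda>(Q, f, Q'). (K Q, K_map Q f, K Q'))"

text \<open>\<open>Idl M\<close> with each ideal replaced by the element of the universe that represents it:\<close>

definition Idl_obj :: "('u set \<Rightarrow> 'u) \<Rightarrow> 'u omagma \<Rightarrow> 'u omagma" where
  "Idl_obj enc M =
     (let dec = inv_into (carrier (Idl M)) enc in
      \<lparr>carrier = enc ` carrier (Idl M), eq = (=),
       le = (\<lambda>x y. dec x \<sqsubseteq>\<^bsub>Idl M\<^esub> dec y),
       mul = (\<lambda>x y. enc (dec x \<cdot>\<^bsub>Idl M\<^esub> dec y))\<rparr>)"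

definition Idl_arr :: "('u set \<Rightarrow> 'u) \<Rightarrow> 'u arrow \<Rightarrow> 'u arrow" where
  "Idl_arr enc = (\<lambda>(M, g, M').
     (Idl_obj enc M,
      \<lambda>x\<in>carrier (Idl_obj enc M). enc (Idl_map M M' g (inv_into (carrier (Idl M)) enc x)),
      Idl_obj enc M'))"

end

theory Submission
  imports Defs
begin

text \<open>
  In a prequantic semilattice \<open>M\<close> the compact ideals are exactly the principal ones, which gives
  \<open>M \<cong> K (Idl M)\<close>. In a precoherent prequantale \<open>Q\<close> every \<open>x\<close> is the supremum of the ideal of compact
  elements below it, and conversely an ideal \<open>I\<close> of \<open>K Q\<close> consists of all compact elements below
  \<open>\<Squnion> I\<close> because \<open>I\<close> is directed; this gives \<open>Q \<cong> Idl (K Q)\<close>. Both maps preserve and reflect the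
  order and respect multiplication, so they are isomorphisms for every structure defined by order
  and multiplication. The distributive laws in \<open>Idl M\<close> hold because for an ideal \<open>L\<close> and an
  element \<open>y\<close> the set \<open>{u. u \<cdot> y \<in> L}\<close> is again an ideal; the same argument with
  \<open>{u. g u \<in> L}\<close> shows that \<open>Idl g\<close> preserves suprema and products.
\<close>

text \<open>As introduction rules for arbitrary \<open>x = y\<close> and \<open>x \<in> carrier L\<close>, these make the classical
  reasoner diverge.\<close>

declare least_closed [rule del, simp del] greatest_closed [rule del, simp del]

context weak_partial_order
begin
declare le_cong_l [rule del] le_cong_r [rule del] weak_refl [rule del, simp del]
end

context partial_order
begin
declare le_antisym [rule del]
end

text \<open>\<open>Idl M\<close> lives over a larger type than \<open>M\<close>, so the functor and
  both natural isomorphisms have to be moved back into the universe. For this reason the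
  constructions are carried out over arbitrary types and then transported along \<open>enc\<close>
  to the copy \<open>Idl_obj enc M\<close>. The notion \<open>omagma_iso\<close> carries the
  transport: it covers the encoding and the two units alike, and it yields invertible arrows in both
  categories at once. Size is controlled only through compact elements: each ideal of a small
  \<open>M\<close> is a subset of a small set and can be encoded, and the compact ideals are indexed
  by \<open>M\<close> itself. The least element takes part throughout as the empty supremum
  \<open>\<Squnion> {}\<close>: the annihilator law is the empty case of distributivity, and
  preservation of the least element is the empty case of preserving finite suprema. Generated ideals
  are handled by one principle: their inclusion in another ideal is tested on generators, which
  reduces laws for ideals to laws for elements.\<close>

abbreviation is_sup :: "('a, 'r) gorder_scheme \<Rightarrow> 'a \<Rightarrow> 'a set \<Rightarrow> bool" where
  "is_sup S s X \<equiv> least S s (Upper S X)"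

text \<open>\<open>Upper\<close> only tests those elements of \<open>X\<close> that lie in the
  carrier. For subsets of the carrier this restriction disappears.\<close>

lemma is_sup_iff:
  assumes "X \<subseteq> carrier S"
  shows "is_sup S s X \<longleftrightarrow> s \<in> carrier S \<and> (\<forall>x\<in>X. x \<sqsubseteq>\<^bsub>S\<^esub> s) \<and>
    (\<forall>u\<in>carrier S. (\<forall>x\<in>X. x \<sqsubseteq>\<^bsub>S\<^esub> u) \<longrightarrow> s \<sqsubseteq>\<^bsub>S\<^esub> u)"
  using assms unfolding least_def Upper_def by blast

lemma compact_elementsI:
  assumes "x \<in> carrier S"
    and "\<And>D s. \<lbrakk>directed_in S D; is_sup S s D; x \<sqsubseteq>\<^bsub>S\<^esub> s\<rbrakk> \<Longrightarrow> \<exists>y\<in>D. x \<sqsubseteq>\<^bsub>S\<^esub> y"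
  shows "x \<in> compact_elements S"
  using assms unfolding compact_elements_def mem_Collect_eq by blast

lemma compact_elementsD:
  assumes "x \<in> compact_elements S" "directed_in S D" "is_sup S s D" "x \<sqsubseteq>\<^bsub>S\<^esub> s"
  shows "\<exists>y\<in>D. x \<sqsubseteq>\<^bsub>S\<^esub> y"
  using assms unfolding compact_elements_def mem_Collect_eq by (elim conjE allE impE) (intro conjI)

lemma partial_orderI:
  assumes "eq S = (=)"
    and "\<And>x. x \<in> carrier S \<Longrightarrow> x \<sqsubseteq>\<^bsub>S\<^esub> x"
    and "\<And>x y. \<lbrakk>x \<in> carrier S; y \<in> carrier S; x \<sqsubseteq>\<^bsub>S\<^esub> y; y \<sqsubseteq>\<^bsub>S\<^esub> x\<rbrakk> \<Longrightarrow> x = y"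
    and "\<And>x y z. \<lbrakk>x \<in> carrier S; y \<in> carrier S; z \<in> carrier S; x \<sqsubseteq>\<^bsub>S\<^esub> y; y \<sqsubseteq>\<^bsub>S\<^esub> z\<rbrakk> \<Longrightarrow> x \<sqsubseteq>\<^bsub>S\<^esub> z"
  shows "partial_order S"
proof
  show "x .=\<^bsub>S\<^esub> y" if "x \<sqsubseteq>\<^bsub>S\<^esub> y" "y \<sqsubseteq>\<^bsub>S\<^esub> x" "x \<in> carrier S" "y \<in> carrier S" for x y
    using assms(1,3) that by simp
  show "x \<sqsubseteq>\<^bsub>S\<^esub> z" if "x \<sqsubseteq>\<^bsub>S\<^esub> y" "y \<sqsubseteq>\<^bsub>S\<^esub> z" "x \<in> carrier S" "y \<in> carrier S" "z \<in> carrier S" for x y z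
    using assms(4) that by blast
qed (use assms(1,2) in auto)

text \<open>\<open>\<Squnion>\<close> is a Hilbert choice among suprema. Antisymmetry leaves only
  one candidate, so exhibiting a supremum determines the value.\<close>

lemma (in partial_order) sup_eqI: "is_sup L s X \<Longrightarrow> \<Squnion> X = s"
  unfolding sup_def by (metis least_unique someI2)

lemma (in prequantale) is_sup_sup: "X \<subseteq> carrier Q \<Longrightarrow> is_sup Q (\<Squnion> X) X"
  using sup_exists sup_eqI by metis

lemma (in prequantale) sup_closed: "X \<subseteq> carrier Q \<Longrightarrow> \<Squnion> X \<in> carrier Q"
  using is_sup_sup by (metis least_closed)

context prequantic_semilattice
begin

text \<open>Binary joins supply the suprema of nonempty finite sets; for the empty set the
  annihilator serves, being a least element.\<close>

lemma is_sup_finite: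
  assumes "finite F" "F \<subseteq> carrier M"
  shows "is_sup M (\<Squnion> F) F"
proof (cases "F = {}")
  case True
  then show ?thesis
    using annihilator sup_eqI[of _ "{}"] by (metis Upper_empty)
qed (use assms finite_sup_least in auto)

text \<open>The annihilator is a least element and hence equals \<open>\<Squnion> {}\<close>. This
  gives zero a canonical name, the one under which morphisms preserve it.\<close>

lemma bot_closed: "\<Squnion> {} \<in> carrier M"
  and bot_least: "x \<in> carrier M \<Longrightarrow> \<Squnion> {} \<sqsubseteq> x"
  and bot_mul: "x \<in> carrier M \<Longrightarrow> \<Squnion> {} \<cdot> x = \<Squnion> {}"
  and mul_bot: "x \<in> carrier M \<Longrightarrow> x \<cdot> \<Squnion> {} = \<Squnion> {}"
proof -
  obtain z where z: "least M z (carrier M)" "\<forall>x\<in>carrier M. z \<cdot> x = z \<and> x \<cdot> z = z"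
    using annihilator by blast
  have "is_sup M z {}"
    using z(1) by (metis Upper_empty)
  then have [simp]: "\<Squnion> {} = z"
    by (rule sup_eqI)
  show "\<Squnion> {} \<in> carrier M" using z(1) by (simp add: least_closed)
  show "\<Squnion> {} \<sqsubseteq> x" if "x \<in> carrier M" using that least_le[OF z(1)] by simp
  show "\<Squnion> {} \<cdot> x = \<Squnion> {}" "x \<cdot> \<Squnion> {} = \<Squnion> {}" if "x \<in> carrier M" using that z(2) by auto
qed

end

section \<open>Isomorphisms of ordered magmas\<close>

text \<open>The two carriers may have different types, so that \<open>enc\<close> and both units
  qualify. Nothing is said about the component \<open>eq\<close>, so lemmas that transport a
  structure to \<open>B\<close> ask for \<open>eq B = (=)\<close>.\<close>

definition omagma_iso :: "'a omagma \<Rightarrow> 'b omagma \<Rightarrow> ('a \<Rightarrow> 'b) \<Rightarrow> bool" where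
  "omagma_iso A B h \<longleftrightarrow> bij_betw h (carrier A) (carrier B) \<and>
     (\<forall>x\<in>carrier A. \<forall>y\<in>carrier A. h x \<sqsubseteq>\<^bsub>B\<^esub> h y \<longleftrightarrow> x \<sqsubseteq>\<^bsub>A\<^esub> y) \<and>
     (\<forall>x\<in>carrier A. \<forall>y\<in>carrier A. h (x \<cdot>\<^bsub>A\<^esub> y) = h x \<cdot>\<^bsub>B\<^esub> h y)"

lemma omagma_iso_inv_apply:
  assumes "omagma_iso A B h"
  shows "x \<in> carrier A \<Longrightarrow> inv_into (carrier A) h (h x) = x"
    and "y \<in> carrier B \<Longrightarrow> h (inv_into (carrier A) h y) = y"
    and "x \<in> carrier A \<Longrightarrow> h x \<in> carrier B"
    and "y \<in> carrier B \<Longrightarrow> inv_into (carrier A) h y \<in> carrier A"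
  using assms unfolding omagma_iso_def
  by (auto simp: bij_betw_def inv_into_into f_inv_into_f)

text \<open>Both sides of the product law have the same image under \<open>h\<close>; closure of
  \<open>A\<close> under multiplication lets the inverse cancel \<open>h\<close> at the
  product.\<close>

lemma omagma_iso_inv:
  assumes "ordered_magma A" and h: "omagma_iso A B h"
  shows "omagma_iso B A (inv_into (carrier A) h)"
proof -
  interpret A: ordered_magma A by fact
  have bij: "bij_betw h (carrier A) (carrier B)"
    using h by (simp add: omagma_iso_def)
  let ?k = "inv_into (carrier A) h"
  have k: "?k x \<in> carrier A" "h (?k x) = x" if "x \<in> carrier B" for x
    using that bij by (auto simp: bij_betw_def inv_into_into f_inv_into_f)
  have kh: "?k (h x) = x" if "x \<in> carrier A" for x
    using that bij by (auto simp: bij_betw_def)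
  have "?k (x \<cdot>\<^bsub>B\<^esub> y) = ?k x \<cdot>\<^bsub>A\<^esub> ?k y" if "x \<in> carrier B" "y \<in> carrier B" for x y
  proof -
    have "h (?k x \<cdot>\<^bsub>A\<^esub> ?k y) = x \<cdot>\<^bsub>B\<^esub> y"
      using h k that by (simp add: omagma_iso_def)
    then show ?thesis
      using kh A.mul_closed k that by metis
  qed
  moreover have "?k x \<sqsubseteq>\<^bsub>A\<^esub> ?k y \<longleftrightarrow> x \<sqsubseteq>\<^bsub>B\<^esub> y" if "x \<in> carrier B" "y \<in> carrier B" for x y
    using h k that unfolding omagma_iso_def by metis
  ultimately show ?thesis
    using bij_betw_inv_into[OF bij] by (simp add: omagma_iso_def)
qed

lemma omagma_iso_comp:
  assumes "omagma_iso A B h" "omagma_iso B C k"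
  shows "omagma_iso A C (k \<circ> h)"
proof -
  have "h x \<in> carrier B" if "x \<in> carrier A" for x
    using that assms(1) by (auto simp: omagma_iso_def bij_betw_def)
  then show ?thesis
    using assms unfolding omagma_iso_def by (auto intro: bij_betw_trans)
qed

text \<open>Units and arrows are undefined off the carrier. This lets an isomorphism be replaced by
  its restriction.\<close>

lemma omagma_iso_cong:
  assumes "omagma_iso A B h" "ordered_magma A" "\<And>x. x \<in> carrier A \<Longrightarrow> k x = h x"
  shows "omagma_iso A B k"
proof -
  have "bij_betw k (carrier A) (carrier B) \<longleftrightarrow> bij_betw h (carrier A) (carrier B)"
    using assms(3) by (intro bij_betw_cong)
  then show ?thesis
    using assms ordered_magma.mul_closed[OF assms(2)] by (simp add: omagma_iso_def)
qed

lemma omagma_iso_is_sup: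
  assumes h: "omagma_iso A B h" and X: "X \<subseteq> carrier A" and s: "is_sup A s X"
  shows "is_sup B (h s) (h ` X)"
proof -
  have B: "carrier B = h ` carrier A"
    using h by (auto simp: omagma_iso_def bij_betw_def)
  then have hX: "h ` X \<subseteq> carrier B"
    using X by auto
  show ?thesis
    using s h X unfolding is_sup_iff[OF hX] is_sup_iff[OF X]
    by (auto simp: omagma_iso_def B subset_iff)
qed

lemma omagma_iso_directed:
  assumes h: "omagma_iso A B h" and D: "directed_in A D"
  shows "directed_in B (h ` D)"
proof -
  have "\<exists>u\<in>h ` D. \<forall>x\<in>F. x \<sqsubseteq>\<^bsub>B\<^esub> u" if F: "finite F" "F \<subseteq> h ` D" for F
  proof -
    obtain F' where F': "finite F'" "F' \<subseteq> D" "F = h ` F'"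
      using finite_subset_image[OF F] by blast
    then obtain u where "u \<in> D" "\<forall>x\<in>F'. x \<sqsubseteq>\<^bsub>A\<^esub> u"
      using D unfolding directed_in_def by meson
    moreover have "D \<subseteq> carrier A"
      using D by (simp add: directed_in_def)
    ultimately have "\<forall>x\<in>F'. h x \<sqsubseteq>\<^bsub>B\<^esub> h u"
      using F'(2) h unfolding omagma_iso_def by (metis subsetD)
    then show ?thesis
      using \<open>u \<in> D\<close> unfolding F'(3) by (intro bexI[of _ "h u"]) auto
  qed
  moreover have "h ` D \<subseteq> carrier B" "h ` D \<noteq> {}"
    using D omagma_iso_inv_apply(3)[OF h] unfolding directed_in_def by blast+
  ultimately show ?thesis
    by (simp add: directed_in_def)
qed

text \<open>A directed set of \<open>B\<close> is pulled back along the inverse, compactness of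
  \<open>c\<close> picks a member there, and applying \<open>h\<close> gives the member
  sought.\<close>

lemma omagma_iso_compact:
  assumes A: "ordered_magma A" and h: "omagma_iso A B h" and c: "c \<in> compact_elements A"
  shows "h c \<in> compact_elements B"
proof -
  let ?k = "inv_into (carrier A) h"
  note k = omagma_iso_inv[OF A h] and kh = omagma_iso_inv_apply[OF h]
  have cA: "c \<in> carrier A"
    using c by (simp add: compact_elements_def)
  have "\<exists>y\<in>D. h c \<sqsubseteq>\<^bsub>B\<^esub> y" if D: "directed_in B D" and s: "is_sup B s D" and cs: "h c \<sqsubseteq>\<^bsub>B\<^esub> s" for D s
  proof -
    have DB: "D \<subseteq> carrier B"
      using D by (simp add: directed_in_def)
    have sB: "s \<in> carrier B"
      using s by (rule least_closed)
    have "directed_in A (?k ` D)" "is_sup A (?k s) (?k ` D)"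
      using omagma_iso_directed[OF k D] omagma_iso_is_sup[OF k DB s] .
    moreover have "c \<sqsubseteq>\<^bsub>A\<^esub> ?k s"
      using cs k cA kh sB unfolding omagma_iso_def by metis
    ultimately obtain y where "y \<in> D" "c \<sqsubseteq>\<^bsub>A\<^esub> ?k y"
      using c unfolding compact_elements_def by blast
    moreover from this have "?k y \<in> carrier A" "h (?k y) = y"
      using DB kh by auto
    ultimately have "h c \<sqsubseteq>\<^bsub>B\<^esub> y"
      using h cA unfolding omagma_iso_def by metis
    then show ?thesis
      using \<open>y \<in> D\<close> by blast
  qed
  then show ?thesis
    using kh(3)[OF cA] unfolding compact_elements_def by blast
qed

lemma omagma_iso_magma_hom: "omagma_iso A B h \<Longrightarrow> magma_hom A B h"
  by (auto simp: omagma_iso_def magma_hom_def bij_betw_def)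

lemma omagma_iso_ordered_magma:
  assumes A: "ordered_magma A" and h: "omagma_iso A B h" and "eq B = (=)"
  shows "ordered_magma B"
proof -
  interpret A: ordered_magma A by fact
  let ?k = "inv_into (carrier A) h"
  note k = omagma_iso_inv[OF A h] and kh = omagma_iso_inv_apply[OF h]
  have le: "x \<sqsubseteq>\<^bsub>B\<^esub> y \<longleftrightarrow> ?k x \<sqsubseteq>\<^bsub>A\<^esub> ?k y" if "x \<in> carrier B" "y \<in> carrier B" for x y
    using that k by (simp add: omagma_iso_def)
  have mul: "x \<cdot>\<^bsub>B\<^esub> y = h (?k x \<cdot>\<^bsub>A\<^esub> ?k y)" if "x \<in> carrier B" "y \<in> carrier B" for x y
    using that h kh by (simp add: omagma_iso_def)
  interpret B: partial_order B
  proof (rule partial_orderI)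
    show "x = y" if "x \<in> carrier B" "y \<in> carrier B" "x \<sqsubseteq>\<^bsub>B\<^esub> y" "y \<sqsubseteq>\<^bsub>B\<^esub> x" for x y
    proof -
      have "?k x = ?k y"
        using that A.le_antisym[of "?k x" "?k y"] by (simp add: le kh)
      then show ?thesis
        using that kh(2) by metis
    qed
    show "x \<sqsubseteq>\<^bsub>B\<^esub> z" if "x \<in> carrier B" "y \<in> carrier B" "z \<in> carrier B" "x \<sqsubseteq>\<^bsub>B\<^esub> y" "y \<sqsubseteq>\<^bsub>B\<^esub> z" for x y z
      using that A.le_trans[of "?k x" "?k y" "?k z"] by (simp add: le kh)
  qed (use assms le kh in auto)
  show ?thesis
  proof
    show mc: "x \<cdot>\<^bsub>B\<^esub> y \<in> carrier B" if "x \<in> carrier B" "y \<in> carrier B" for x y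
      using that mul kh A.mul_closed by metis
    show "x \<cdot>\<^bsub>B\<^esub> y \<sqsubseteq>\<^bsub>B\<^esub> x' \<cdot>\<^bsub>B\<^esub> y'"
      if "x \<in> carrier B" "x' \<in> carrier B" "y \<in> carrier B" "y' \<in> carrier B" "x \<sqsubseteq>\<^bsub>B\<^esub> x'" "y \<sqsubseteq>\<^bsub>B\<^esub> y'"
      for x x' y y'
      using that mc A.mul_closed A.mul_mono by (simp add: le mul kh)
  qed
qed

text \<open>Every element and every subset of \<open>B\<close> is the image of one of
  \<open>A\<close>, and \<open>h\<close> commutes with suprema and products, so each distributive
  law of \<open>B\<close> is the image of the same law of \<open>A\<close>.\<close>

lemma omagma_iso_prequantale:
  assumes A: "prequantale A" and h: "omagma_iso A B h" and eq: "eq B = (=)"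
  shows "prequantale B"
proof -
  interpret A: prequantale A by fact
  interpret B: ordered_magma B
    using omagma_iso_ordered_magma[OF A.ordered_magma_axioms h eq] .
  let ?k = "inv_into (carrier A) h"
  note kh = omagma_iso_inv_apply[OF h]
  have mul: "h (x \<cdot>\<^bsub>A\<^esub> y) = h x \<cdot>\<^bsub>B\<^esub> h y" if "x \<in> carrier A" "y \<in> carrier A" for x y
    using h that by (simp add: omagma_iso_def)
  have sup: "\<Squnion>\<^bsub>B\<^esub> (h ` X) = h (\<Squnion>\<^bsub>A\<^esub> X)" if "X \<subseteq> carrier A" for X
    using B.sup_eqI[OF omagma_iso_is_sup[OF h that A.is_sup_sup[OF that]]] .
  have ex: "\<exists>X'\<subseteq>carrier A. X = h ` X'" if "X \<subseteq> carrier B" for X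
    using that h unfolding omagma_iso_def bij_betw_def by (metis subset_image_iff)
  have exel: "\<exists>a'\<in>carrier A. a = h a'" if "a \<in> carrier B" for a
    using that kh by metis
  show ?thesis
  proof
    fix X assume "X \<subseteq> carrier B"
    then obtain X' where X': "X' \<subseteq> carrier A" "X = h ` X'"
      using ex by blast
    then show "\<exists>s. is_sup B s X"
      using omagma_iso_is_sup[OF h X'(1) A.is_sup_sup[OF X'(1)]] by blast
    fix a assume "a \<in> carrier B"
    then obtain a' where a': "a' \<in> carrier A" "a = h a'"
      using exel by blast
    have "a \<cdot>\<^bsub>B\<^esub> \<Squnion>\<^bsub>B\<^esub> X = h (\<Squnion>\<^bsub>A\<^esub> ((\<lambda>x. a' \<cdot>\<^bsub>A\<^esub> x) ` X'))"
      using X' a' A.sup_closed mul by (simp add: sup flip: A.mul_sup)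
    also have "\<dots> = \<Squnion>\<^bsub>B\<^esub> (h ` (\<lambda>x. a' \<cdot>\<^bsub>A\<^esub> x) ` X')"
      by (rule sup[symmetric]) (use X' a' A.mul_closed in auto)
    also have "h ` (\<lambda>x. a' \<cdot>\<^bsub>A\<^esub> x) ` X' = (\<lambda>x. a \<cdot>\<^bsub>B\<^esub> x) ` X"
      unfolding X' a' image_image using a' X' mul by (intro image_cong) auto
    finally show "a \<cdot>\<^bsub>B\<^esub> \<Squnion>\<^bsub>B\<^esub> X = \<Squnion>\<^bsub>B\<^esub> ((\<lambda>x. a \<cdot>\<^bsub>B\<^esub> x) ` X)" .
    have "\<Squnion>\<^bsub>B\<^esub> X \<cdot>\<^bsub>B\<^esub> a = h (\<Squnion>\<^bsub>A\<^esub> ((\<lambda>x. x \<cdot>\<^bsub>A\<^esub> a') ` X'))"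
      using X' a' A.sup_closed mul by (simp add: sup flip: A.sup_mul)
    also have "\<dots> = \<Squnion>\<^bsub>B\<^esub> (h ` (\<lambda>x. x \<cdot>\<^bsub>A\<^esub> a') ` X')"
      by (rule sup[symmetric]) (use X' a' A.mul_closed in auto)
    also have "h ` (\<lambda>x. x \<cdot>\<^bsub>A\<^esub> a') ` X' = (\<lambda>x. x \<cdot>\<^bsub>B\<^esub> a) ` X"
      unfolding X' a' image_image using a' X' mul by (intro image_cong) auto
    finally show "\<Squnion>\<^bsub>B\<^esub> X \<cdot>\<^bsub>B\<^esub> a = \<Squnion>\<^bsub>B\<^esub> ((\<lambda>x. x \<cdot>\<^bsub>B\<^esub> a) ` X)" .
  qed
qed

lemma omagma_iso_precoherent_prequantale:
  assumes A: "precoherent_prequantale A" and h: "omagma_iso A B h" and eq: "eq B = (=)"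
  shows "precoherent_prequantale B"
proof -
  have prec: "prequantale A" "precoherent A"
    using A by (auto simp: precoherent_prequantale_def)
  interpret A: prequantale A by fact
  note om = A.ordered_magma_axioms
  let ?k = "inv_into (carrier A) h"
  note kh = omagma_iso_inv_apply[OF h]
  interpret B: prequantale B
    using omagma_iso_prequantale[OF prec(1) h eq] .
  have k: "omagma_iso B A ?k"
    using omagma_iso_inv[OF om h] .
  have cc: "h ` compact_elements A \<subseteq> compact_elements B"
    using omagma_iso_compact[OF om h] by blast
  \<comment> \<open>Compactness also travels along the inverse, so together with \<open>cc\<close>
    the compact elements of \<open>B\<close> are exactly the images of those of
    \<open>A\<close>.\<close>
  have cB: "\<exists>a\<in>compact_elements A. b = h a" if "b \<in> compact_elements B" for b
  proof
    show "?k b \<in> compact_elements A"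
      using omagma_iso_compact[OF B.ordered_magma_axioms k that] .
    show "b = h (?k b)"
      using that kh by (simp add: compact_elements_def)
  qed
  have "\<exists>X. X \<subseteq> compact_elements B \<and> is_sup B x X" if "x \<in> carrier B" for x
  proof -
    have "?k x \<in> carrier A"
      using kh that by blast
    then obtain X where X: "X \<subseteq> compact_elements A" "is_sup A (?k x) X"
      using prec(2) unfolding precoherent_def by blast
    then have XA: "X \<subseteq> carrier A"
      by (auto simp: compact_elements_def)
    have "is_sup B x (h ` X)"
      using omagma_iso_is_sup[OF h XA X(2)] unfolding kh(2)[OF that] .
    moreover have "h ` X \<subseteq> compact_elements B"
      using X(1) cc by blast
    ultimately show ?thesis
      by (intro exI conjI)
  qed
  moreover have "b \<cdot>\<^bsub>B\<^esub> b' \<in> compact_elements B"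
    if b: "b \<in> compact_elements B" and b': "b' \<in> compact_elements B" for b b'
  proof -
    obtain a a' where a: "a \<in> compact_elements A" "b = h a" "a' \<in> compact_elements A" "b' = h a'"
      using cB[OF b] cB[OF b'] by blast
    then have "a \<cdot>\<^bsub>A\<^esub> a' \<in> compact_elements A"
      using prec(2) by (auto simp: precoherent_def)
    moreover have "h (a \<cdot>\<^bsub>A\<^esub> a') = b \<cdot>\<^bsub>B\<^esub> b'"
      using a h by (simp add: omagma_iso_def compact_elements_def)
    ultimately show ?thesis
      using cc by (metis image_subset_iff)
  qed
  ultimately show ?thesis
    by (simp add: precoherent_prequantale_def precoherent_def B.prequantale_axioms
        B.ordered_magma_axioms)
qed

lemma omagma_iso_precoherent_prequantale_morphism:
  assumes A: "precoherent_prequantale A" and B: "precoherent_prequantale B" and h: "omagma_iso A B h"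
  shows "precoherent_prequantale_morphism A B h"
proof -
  interpret A: prequantale A using A by (simp add: precoherent_prequantale_def)
  interpret B: prequantale B using B by (simp add: precoherent_prequantale_def)
  have "h (\<Squnion>\<^bsub>A\<^esub> X) = \<Squnion>\<^bsub>B\<^esub> (h ` X)" if "X \<subseteq> carrier A" for X
    using B.sup_eqI[OF omagma_iso_is_sup[OF h that A.is_sup_sup[OF that]]] by simp
  then show ?thesis
    using A B omagma_iso_compact[OF A.ordered_magma_axioms h] omagma_iso_magma_hom[OF h]
    by (auto simp: precoherent_prequantale_morphism_def prequantale_morphism_def
        A.prequantale_axioms B.prequantale_axioms)
qed

lemma omagma_iso_prequantic_semilattice_morphism:
  assumes A: "prequantic_semilattice A" and B: "prequantic_semilattice B" and h: "omagma_iso A B h"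
  shows "prequantic_semilattice_morphism A B h"
proof -
  interpret A: prequantic_semilattice A by fact
  interpret B: prequantic_semilattice B by fact
  have "h (\<Squnion>\<^bsub>A\<^esub> X) = \<Squnion>\<^bsub>B\<^esub> (h ` X)" if "finite X" "X \<subseteq> carrier A" for X
    using B.sup_eqI[OF omagma_iso_is_sup[OF h that(2) A.is_sup_finite[OF that]]] by simp
  then show ?thesis
    using A B omagma_iso_magma_hom[OF h]
    by (auto simp: prequantic_semilattice_morphism_def)
qed

lemma omagma_iso_precoherent_prequantale_iso:
  assumes "precoherent_prequantale A" "precoherent_prequantale B" "omagma_iso A B h"
  shows "precoherent_prequantale_iso A B h"
proof -
  have "ordered_magma A"
    using assms(1) by (simp add: precoherent_prequantale_def precoherent_def)
  then show ?thesis
    unfolding precoherent_prequantale_iso_def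
    using omagma_iso_precoherent_prequantale_morphism[OF assms]
      omagma_iso_precoherent_prequantale_morphism[OF assms(2,1) omagma_iso_inv[OF _ assms(3)]]
      omagma_iso_inv_apply[OF assms(3)]
    by blast
qed

lemma omagma_iso_prequantic_semilattice_iso:
  assumes "prequantic_semilattice A" "prequantic_semilattice B" "omagma_iso A B h"
  shows "prequantic_semilattice_iso A B h"
proof -
  have "ordered_magma A"
    using assms(1) by (simp add: prequantic_semilattice_def)
  then show ?thesis
    unfolding prequantic_semilattice_iso_def
    using omagma_iso_prequantic_semilattice_morphism[OF assms]
      omagma_iso_prequantic_semilattice_morphism[OF assms(2,1) omagma_iso_inv[OF _ assms(3)]]
      omagma_iso_inv_apply[OF assms(3)]
    by blast
qed

section \<open>The compact elements of a precoherent prequantale\<close>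

lemma K_simps [simp]:
  "carrier (K Q) = compact_elements Q" "le (K Q) = le Q" "mul (K Q) = mul Q" "eq (K Q) = eq Q"
  by (simp_all add: K_def)

lemma compact_carrier: "x \<in> compact_elements S \<Longrightarrow> x \<in> carrier S"
  by (simp add: compact_elements_def)

lemma compact_subset_carrier: "compact_elements S \<subseteq> carrier S"
  by (auto simp: compact_elements_def)

text \<open>The predicate \<open>precoherent_prequantale\<close> recast as a locale, so that its
  consequences can be interpreted for the domain and the codomain of a morphism side by
  side.\<close>

locale precoherent_prequantale_loc = prequantale Q for Q :: "'a omagma" (structure) +
  assumes compactly_generated:
      "x \<in> carrier Q \<Longrightarrow> \<exists>X. X \<subseteq> compact_elements Q \<and> is_sup Q x X"
    and compact_mul:
      "\<lbrakk>x \<in> compact_elements Q; y \<in> compact_elements Q\<rbrakk> \<Longrightarrow> x \<cdot> y \<in> compact_elements Q"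

lemma precoherent_prequantale_loc_iff:
  "precoherent_prequantale Q \<longleftrightarrow> precoherent_prequantale_loc Q"
  unfolding precoherent_prequantale_def precoherent_def precoherent_prequantale_loc_def
    precoherent_prequantale_loc_axioms_def
  by (auto dest: prequantale.axioms(1))

lemma (in prequantale) le_sup: "\<lbrakk>X \<subseteq> carrier Q; x \<in> X\<rbrakk> \<Longrightarrow> x \<sqsubseteq> \<Squnion> X"
  by (rule least_Upper_above[OF is_sup_sup])

lemma (in prequantale) sup_le:
  "\<lbrakk>X \<subseteq> carrier Q; u \<in> carrier Q; \<And>x. x \<in> X \<Longrightarrow> x \<sqsubseteq> u\<rbrakk> \<Longrightarrow> \<Squnion> X \<sqsubseteq> u"
  by (rule least_le[OF is_sup_sup Upper_memI])

lemma directed_bound: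
  assumes "directed_in S D" "finite F" "F \<subseteq> D"
  shows "\<exists>u\<in>D. \<forall>x\<in>F. x \<sqsubseteq>\<^bsub>S\<^esub> u"
  using assms unfolding directed_in_def by blast

context precoherent_prequantale_loc
begin

text \<open>Compactness of each member of \<open>F\<close> yields one element of \<open>D\<close>
  per member; these are finitely many, so directedness bounds all of them by a single element. The
  case \<open>F = {}\<close> makes the least element compact, which supplies the annihilator of
  \<open>K Q\<close>.\<close>

lemma compact_sup:
  assumes F: "finite F" "F \<subseteq> compact_elements Q"
  shows "\<Squnion> F \<in> compact_elements Q"
proof -
  have Fc: "F \<subseteq> carrier Q"
    by (rule subset_trans[OF F(2) compact_subset_carrier])
  have "\<exists>y\<in>D. \<Squnion> F \<sqsubseteq> y" if D: "directed_in Q D" and s: "is_sup Q s D" and le: "\<Squnion> F \<sqsubseteq> s" for D s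
  proof -
    have DQ: "D \<subseteq> carrier Q"
      using D by (simp add: directed_in_def)
    have sQ: "s \<in> carrier Q"
      using s by (rule least_closed)
    have "\<exists>y\<in>D. x \<sqsubseteq> y" if "x \<in> F" for x
    proof -
      have "x \<sqsubseteq> \<Squnion> F"
        using le_sup[OF Fc that] .
      then have "x \<sqsubseteq> s"
        using le_trans[OF _ le] Fc that sQ sup_closed[OF Fc] by blast
      then show ?thesis
        using compact_elementsD[OF _ D s] F(2) that by blast
    qed
    then obtain d where d: "\<And>x. x \<in> F \<Longrightarrow> d x \<in> D \<and> x \<sqsubseteq> d x"
      by metis
    obtain u where u: "u \<in> D" "\<forall>x\<in>d ` F. x \<sqsubseteq> u"
      using directed_bound[OF D, of "d ` F"] d F(1) by blast
    have "\<Squnion> F \<sqsubseteq> u"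
    proof (rule sup_le[OF Fc])
      show "u \<in> carrier Q"
        using u DQ by blast
      show "x \<sqsubseteq> u" if "x \<in> F" for x
        using le_trans[of x "d x" u] d[OF that] u that Fc DQ by blast
    qed
    then show ?thesis
      using u by blast
  qed
  then show ?thesis
    by (rule compact_elementsI[OF sup_closed[OF Fc]])
qed

text \<open>The supremum formed in \<open>Q\<close> is itself compact, so it remains the least upper
  bound in the smaller poset \<open>K Q\<close>.\<close>

lemma is_sup_K:
  assumes F: "finite F" "F \<subseteq> compact_elements Q"
  shows "is_sup (K Q) (\<Squnion> F) F"
proof -
  have "F \<subseteq> carrier Q"
    by (rule subset_trans[OF F(2) compact_subset_carrier])
  then show ?thesis
    using F compact_sup[OF F] le_sup[of F] sup_le[of F]
    by (subst is_sup_iff) (simp_all add: compact_carrier)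
qed

lemma ordered_magma_K: "ordered_magma (K Q)"
proof -
  interpret K: partial_order "K Q"
  proof (rule partial_orderI)
    show "x \<sqsubseteq>\<^bsub>K Q\<^esub> z"
      if "x \<in> carrier (K Q)" "y \<in> carrier (K Q)" "z \<in> carrier (K Q)" "x \<sqsubseteq>\<^bsub>K Q\<^esub> y" "y \<sqsubseteq>\<^bsub>K Q\<^esub> z" for x y z
      using le_trans[of x y z] that by (simp add: compact_carrier)
  qed (use eq_is_equal le_antisym in \<open>auto simp: compact_carrier\<close>)
  show ?thesis
    by unfold_locales (auto simp: compact_mul mul_mono compact_carrier)
qed

lemma sup_K: "\<lbrakk>finite F; F \<subseteq> compact_elements Q\<rbrakk> \<Longrightarrow> \<Squnion>\<^bsub>K Q\<^esub> F = \<Squnion> F"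
  by (rule partial_order.sup_eqI[OF ordered_magma.axioms(1)[OF ordered_magma_K] is_sup_K])

lemma prequantic_semilattice_K: "prequantic_semilattice (K Q)"
proof -
  interpret K: ordered_magma "K Q"
    by (rule ordered_magma_K)
  have join: "x \<squnion>\<^bsub>K Q\<^esub> y = \<Squnion> {x, y}" if "x \<in> compact_elements Q" "y \<in> compact_elements Q" for x y
    using that by (simp add: join_def sup_K)
  \<comment> \<open>Distributivity over arbitrary suprema, taken at the empty set, is the
    annihilator law.\<close>
  have bot: "\<Squnion> {} \<cdot> x = \<Squnion> {}" "x \<cdot> \<Squnion> {} = \<Squnion> {}" if "x \<in> carrier Q" for x
    using mul_sup[of x "{}"] sup_mul[of x "{}"] that by simp_all
  show ?thesis
  proof
    show "\<exists>s. is_sup (K Q) s {x, y}" if "x \<in> carrier (K Q)" "y \<in> carrier (K Q)" for x y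
      using is_sup_K[of "{x, y}"] that by auto
    show "a \<cdot>\<^bsub>K Q\<^esub> (x \<squnion>\<^bsub>K Q\<^esub> y) = (a \<cdot>\<^bsub>K Q\<^esub> x) \<squnion>\<^bsub>K Q\<^esub> (a \<cdot>\<^bsub>K Q\<^esub> y)"
      "(x \<squnion>\<^bsub>K Q\<^esub> y) \<cdot>\<^bsub>K Q\<^esub> a = (x \<cdot>\<^bsub>K Q\<^esub> a) \<squnion>\<^bsub>K Q\<^esub> (y \<cdot>\<^bsub>K Q\<^esub> a)"
      if "a \<in> carrier (K Q)" "x \<in> carrier (K Q)" "y \<in> carrier (K Q)" for a x y
      using that mul_sup[of a "{x, y}"] sup_mul[of a "{x, y}"]
      by (simp_all add: join compact_mul compact_carrier)
    have "least (K Q) (\<Squnion> {}) (carrier (K Q))"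
      using is_sup_K[of "{}"] by simp
    then show "\<exists>z. least (K Q) z (carrier (K Q)) \<and>
        (\<forall>x\<in>carrier (K Q). z \<cdot>\<^bsub>K Q\<^esub> x = z \<and> x \<cdot>\<^bsub>K Q\<^esub> z = z)"
      using bot by (intro exI[of _ "\<Squnion> {}"]) (auto simp: compact_carrier)
  qed
qed

end

lemma K_map_apply: "x \<in> compact_elements Q \<Longrightarrow> K_map Q f x = f x"
  by (simp add: K_map_def)

text \<open>Finite suprema of compact elements agree in \<open>K Q\<close> and in \<open>Q\<close>,
  so their preservation is inherited from \<open>f\<close>.\<close>

lemma prequantic_semilattice_morphism_K_map:
  assumes f: "precoherent_prequantale_morphism Q Q' f"
  shows "prequantic_semilattice_morphism (K Q) (K Q') (K_map Q f)"
proof -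
  interpret Q: precoherent_prequantale_loc Q
    using f by (simp add: precoherent_prequantale_morphism_def precoherent_prequantale_loc_iff)
  interpret Q': precoherent_prequantale_loc Q'
    using f by (simp add: precoherent_prequantale_morphism_def precoherent_prequantale_loc_iff)
  have fc: "f x \<in> compact_elements Q'" if "x \<in> compact_elements Q" for x
    using f that by (auto simp: precoherent_prequantale_morphism_def)
  have "K_map Q f (\<Squnion>\<^bsub>K Q\<^esub> X) = \<Squnion>\<^bsub>K Q'\<^esub> (K_map Q f ` X)"
    if X: "finite X" "X \<subseteq> compact_elements Q" for X
  proof -
    have "K_map Q f ` X = f ` X"
      using X by (intro image_cong) (auto simp: K_map_apply)
    moreover have "f (\<Squnion>\<^bsub>Q\<^esub> X) = \<Squnion>\<^bsub>Q'\<^esub> (f ` X)"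
      using f X compact_subset_carrier[of Q]
      unfolding precoherent_prequantale_morphism_def prequantale_morphism_def by blast
    moreover have "f ` X \<subseteq> compact_elements Q'"
      using X fc by blast
    ultimately show ?thesis
      using X by (simp add: K_map_apply Q.sup_K Q'.sup_K Q.compact_sup)
  qed
  moreover have "magma_hom (K Q) (K Q') (K_map Q f)"
    using f fc
    by (auto simp: magma_hom_def K_map_apply Q.compact_mul precoherent_prequantale_morphism_def
        prequantale_morphism_def compact_carrier)
  ultimately show ?thesis
    by (simp add: prequantic_semilattice_morphism_def Q.prequantic_semilattice_K
        Q'.prequantic_semilattice_K)
qed

section \<open>Ideals of a prequantic semilattice\<close>

lemma Idl_simps [simp]:
  "carrier (Idl M) = ideals M" "le (Idl M) = (\<subseteq>)" "eq (Idl M) = (=)"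
  by (simp_all add: Idl_def)

lemma Idl_mul: "I \<cdot>\<^bsub>Idl M\<^esub> J = down M {x \<cdot>\<^bsub>M\<^esub> y | x y. x \<in> I \<and> y \<in> J}"
  by (simp add: Idl_def)

lemma partial_order_Idl: "partial_order (Idl M)"
  by (rule partial_orderI) auto

lemma ideal_subset: "I \<in> ideals S \<Longrightarrow> I \<subseteq> carrier S"
  and ideal_nonempty: "I \<in> ideals S \<Longrightarrow> I \<noteq> {}"
  by (auto simp: ideals_def directed_in_def)

lemma ideal_downward: "\<lbrakk>I \<in> ideals S; x \<in> I; y \<in> carrier S; y \<sqsubseteq>\<^bsub>S\<^esub> x\<rbrakk> \<Longrightarrow> y \<in> I"
  by (auto simp: ideals_def)

context prequantic_semilattice
begin

lemma finite_sup:
  assumes "finite F" "F \<subseteq> carrier M"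
  shows finite_sup_in_carrier: "\<Squnion> F \<in> carrier M"
    and le_finite_sup: "x \<in> F \<Longrightarrow> x \<sqsubseteq> \<Squnion> F"
    and finite_sup_le: "\<lbrakk>u \<in> carrier M; \<And>x. x \<in> F \<Longrightarrow> x \<sqsubseteq> u\<rbrakk> \<Longrightarrow> \<Squnion> F \<sqsubseteq> u"
  using is_sup_finite[OF assms] unfolding is_sup_iff[OF assms(2)] by blast+

text \<open>A directed downward closed set contains a bound of any two of its members and therefore
  their join; conversely, bounds of finite subsets are built by joining one element at a time,
  beginning with \<open>\<Squnion> {}\<close>. In this form preimages under multiplication and under
  morphisms are easily recognised as ideals.\<close>

lemma ideals_iff:
  "I \<in> ideals M \<longleftrightarrow> I \<subseteq> carrier M \<and> \<Squnion> {} \<in> I \<and> (\<forall>x\<in>I. \<forall>y\<in>I. x \<squnion> y \<in> I) \<and>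
     (\<forall>x\<in>I. \<forall>y\<in>carrier M. y \<sqsubseteq> x \<longrightarrow> y \<in> I)"
proof
  assume I: "I \<in> ideals M"
  note sub = ideal_subset[OF I] and dw = ideal_downward[OF I]
  have dir: "directed_in M I"
    using I by (simp add: ideals_def)
  have "x \<squnion> y \<in> I" if xy: "x \<in> I" "y \<in> I" for x y
  proof -
    obtain u where u: "u \<in> I" "x \<sqsubseteq> u" "y \<sqsubseteq> u"
      using directed_bound[OF dir, of "{x, y}"] xy by blast
    moreover have "x \<in> carrier M" "y \<in> carrier M" "u \<in> carrier M"
      using xy u sub by auto
    ultimately show ?thesis
      using dw[OF u(1)] join_le by simp
  qed
  moreover have "\<Squnion> {} \<in> I"
    using ideal_nonempty[OF I] sub dw bot_closed bot_least by blast
  ultimately show "I \<subseteq> carrier M \<and> \<Squnion> {} \<in> I \<and> (\<forall>x\<in>I. \<forall>y\<in>I. x \<squnion> y \<in> I) \<and>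
     (\<forall>x\<in>I. \<forall>y\<in>carrier M. y \<sqsubseteq> x \<longrightarrow> y \<in> I)"
    using sub dw by blast
next
  assume I: "I \<subseteq> carrier M \<and> \<Squnion> {} \<in> I \<and> (\<forall>x\<in>I. \<forall>y\<in>I. x \<squnion> y \<in> I) \<and>
     (\<forall>x\<in>I. \<forall>y\<in>carrier M. y \<sqsubseteq> x \<longrightarrow> y \<in> I)"
  have "\<exists>u\<in>I. \<forall>x\<in>F. x \<sqsubseteq> u" if "finite F" "F \<subseteq> I" for F
    using that
  proof (induction F rule: finite_induct)
    case empty
    then show ?case using I by blast
  next
    case (insert x F)
    then obtain u where u: "u \<in> I" "\<forall>x\<in>F. x \<sqsubseteq> u"
      by auto
    have c: "x \<in> carrier M" "u \<in> carrier M" "F \<subseteq> carrier M"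
      using I insert.prems u(1) by blast+
    have "x \<squnion> u \<in> I"
      using insert u I by blast
    moreover have "y \<sqsubseteq> x \<squnion> u" if "y \<in> F" for y
      using u(2) that c join_right[of x u] le_trans[of y u "x \<squnion> u"] by auto
    moreover have "x \<sqsubseteq> x \<squnion> u"
      using c join_left by blast
    ultimately show ?case
      by blast
  qed
  then show "I \<in> ideals M"
    using I by (auto simp: ideals_def directed_in_def)
qed

lemma ideal_bot: "I \<in> ideals M \<Longrightarrow> \<Squnion> {} \<in> I"
  and ideal_join: "\<lbrakk>I \<in> ideals M; x \<in> I; y \<in> I\<rbrakk> \<Longrightarrow> x \<squnion> y \<in> I"
  by (simp_all add: ideals_iff)

lemma idealI:
  assumes "I \<subseteq> carrier M" "\<Squnion> {} \<in> I" "\<And>x y. \<lbrakk>x \<in> I; y \<in> I\<rbrakk> \<Longrightarrow> x \<squnion> y \<in> I"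
    "\<And>x y. \<lbrakk>x \<in> I; y \<in> carrier M; y \<sqsubseteq> x\<rbrakk> \<Longrightarrow> y \<in> I"
  shows "I \<in> ideals M"
  using assms unfolding ideals_iff by blast

lemma subset_down:
  assumes "X \<subseteq> carrier M"
  shows "X \<subseteq> down M X"
proof
  fix x assume x: "x \<in> X"
  then have "x \<sqsubseteq> \<Squnion> {x}"
    using le_finite_sup[of "{x}" x] assms by auto
  moreover have "x \<in> carrier M"
    using x assms by auto
  ultimately show "x \<in> down M X"
    using x unfolding down_def by blast
qed

text \<open>Witnesses \<open>S\<close> and \<open>T\<close> for two members combine to
  \<open>S \<union> T\<close>, whose supremum bounds the join. Since \<open>down\<close> admits only
  nonempty \<open>T\<close>, some element of \<open>X\<close> is needed to place the least element
  in the ideal.\<close>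

lemma down_ideal:
  assumes X: "X \<subseteq> carrier M" "X \<noteq> {}"
  shows "down M X \<in> ideals M"
proof (rule idealI)
  have sub: "\<Squnion> T \<in> carrier M" if "finite T" "T \<subseteq> X" for T
    using finite_sup_in_carrier[of T] X that by blast
  show "down M X \<subseteq> carrier M"
    by (auto simp: down_def)
  obtain x where x: "x \<in> X"
    using X by blast
  show "\<Squnion> {} \<in> down M X"
    using x bot_closed bot_least[OF sub[of "{x}"]] unfolding down_def by blast
  show "x \<squnion> y \<in> down M X" if xy: "x \<in> down M X" "y \<in> down M X" for x y
  proof -
    have c: "x \<in> carrier M" "y \<in> carrier M"
      using xy by (auto simp: down_def)
    obtain S T where ST: "finite S" "finite T" "S \<noteq> {}" "S \<subseteq> X" "T \<subseteq> X" "x \<sqsubseteq> \<Squnion> S" "y \<sqsubseteq> \<Squnion> T"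
      using xy by (auto simp: down_def)
    have mono: "\<Squnion> U \<sqsubseteq> \<Squnion> (S \<union> T)" if "U \<subseteq> S \<union> T" for U
    proof -
      have U: "finite U" "U \<subseteq> carrier M" "finite (S \<union> T)" "S \<union> T \<subseteq> carrier M"
        using that ST X by (auto intro: finite_subset)
      show ?thesis
        using that
        by (intro finite_sup_le[OF U(1,2)] finite_sup_in_carrier[OF U(3,4)] le_finite_sup[OF U(3,4)])
          auto
    qed
    have "x \<squnion> y \<sqsubseteq> \<Squnion> (S \<union> T)"
    proof (rule join_le)
      show "x \<sqsubseteq> \<Squnion> (S \<union> T)"
        by (rule le_trans[OF ST(6) mono]) (use c ST sub in auto)
      show "y \<sqsubseteq> \<Squnion> (S \<union> T)"
        by (rule le_trans[OF ST(7) mono]) (use c ST sub in auto)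
    qed (use c ST sub in auto)
    moreover have "finite (S \<union> T)" "S \<union> T \<noteq> {}" "S \<union> T \<subseteq> X"
      using ST by auto
    moreover have "x \<squnion> y \<in> carrier M"
      using c by simp
    ultimately show ?thesis
      unfolding down_def by blast
  qed
  show "y \<in> down M X" if x: "x \<in> down M X" and y: "y \<in> carrier M" "y \<sqsubseteq> x" for x y
  proof -
    obtain T where T: "finite T" "T \<noteq> {}" "T \<subseteq> X" "x \<sqsubseteq> \<Squnion> T" "x \<in> carrier M"
      using x by (auto simp: down_def)
    then have "y \<sqsubseteq> \<Squnion> T"
      using le_trans[of y x "\<Squnion> T"] y sub by blast
    then show ?thesis
      using T y unfolding down_def by blast
  qed
qed

text \<open>Directedness provides a bound in \<open>I\<close> for each finite set \<open>T\<close>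
  of generators, so everything below \<open>\<Squnion> T\<close> lies in \<open>I\<close>. With
  \<open>subset_down\<close>, this makes \<open>down M X\<close> for nonempty \<open>X\<close> the
  least ideal containing \<open>X\<close>.\<close>

lemma down_least:
  assumes X: "X \<subseteq> I" and I: "I \<in> ideals M"
  shows "down M X \<subseteq> I"
proof
  fix y assume "y \<in> down M X"
  then obtain T where T: "finite T" "T \<subseteq> X" "y \<sqsubseteq> \<Squnion> T" "y \<in> carrier M"
    by (auto simp: down_def)
  have dir: "directed_in M I"
    using I by (simp add: ideals_def)
  obtain u where u: "u \<in> I" "\<forall>x\<in>T. x \<sqsubseteq> u"
    using directed_bound[OF dir T(1)] T X by blast
  have TM: "T \<subseteq> carrier M" and uM: "u \<in> carrier M"
    using T X ideal_subset[OF I] u by auto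
  have "\<Squnion> T \<in> carrier M" "\<Squnion> T \<sqsubseteq> u"
    using finite_sup_in_carrier[OF T(1) TM] finite_sup_le[OF T(1) TM uM] u by blast+
  then have "y \<sqsubseteq> u"
    using T le_trans uM by blast
  then show "y \<in> I"
    using ideal_downward[OF I u(1)] T by blast
qed

lemma down_subset_iff:
  assumes "X \<subseteq> carrier M" "I \<in> ideals M"
  shows "down M X \<subseteq> I \<longleftrightarrow> X \<subseteq> I"
  using subset_down[OF assms(1)] down_least[OF _ assms(2)] by blast

text \<open>The condition passes from generators to generated ideals one factor at a time: for fixed
  \<open>y\<close> in \<open>B\<close> the left factor is extended to \<open>down M A\<close>, and
  then for fixed \<open>u\<close> in \<open>down M A\<close> the right factor is extended to
  \<open>down M B\<close>.\<close>

lemma down_mul_subset: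
  assumes A: "A \<subseteq> carrier M" and B: "B \<subseteq> carrier M" and L: "L \<in> ideals M"
    and AB: "\<And>x y. \<lbrakk>x \<in> A; y \<in> B\<rbrakk> \<Longrightarrow> x \<cdot> y \<in> L"
    and u: "u \<in> down M A" and v: "v \<in> down M B"
  shows "u \<cdot> v \<in> L"
proof -
  note dw = ideal_downward[OF L]
  \<comment> \<open>The annihilator puts the least element into this set, distributivity gives
    closure under joins, and monotonicity of multiplication gives downward closure.\<close>
  have 1: "{u \<in> carrier M. u \<cdot> y \<in> L} \<in> ideals M" if y: "y \<in> carrier M" for y
  proof (rule idealI)
    show "\<Squnion> {} \<in> {u \<in> carrier M. u \<cdot> y \<in> L}"
      using bot_mul[OF y] bot_closed ideal_bot[OF L] by simp
    show "z \<in> {u \<in> carrier M. u \<cdot> y \<in> L}"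
      if "x \<in> {u \<in> carrier M. u \<cdot> y \<in> L}" "z \<in> carrier M" "z \<sqsubseteq> x" for x z
      using that y dw[of "x \<cdot> y" "z \<cdot> y"] mul_mono[of z x y y] mul_closed by simp
  qed (auto simp: join_mul y ideal_join[OF L])
  have 2: "{u \<in> carrier M. y \<cdot> u \<in> L} \<in> ideals M" if y: "y \<in> carrier M" for y
  proof (rule idealI)
    show "\<Squnion> {} \<in> {u \<in> carrier M. y \<cdot> u \<in> L}"
      using mul_bot[OF y] bot_closed ideal_bot[OF L] by simp
    show "z \<in> {u \<in> carrier M. y \<cdot> u \<in> L}"
      if "x \<in> {u \<in> carrier M. y \<cdot> u \<in> L}" "z \<in> carrier M" "z \<sqsubseteq> x" for x z
      using that y dw[of "y \<cdot> x" "y \<cdot> z"] mul_mono[of y y z x] mul_closed by simp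
  qed (auto simp: mul_join y ideal_join[OF L])
  have "u \<cdot> y \<in> L" if "y \<in> B" for y
    using down_least[OF _ 1[of y], of A] A B AB that u by blast
  moreover have "u \<in> carrier M"
    using u by (simp add: down_def)
  ultimately show ?thesis
    using down_least[OF _ 2[of u], of B] B v by blast
qed

section \<open>Products and suprema of ideals\<close>

lemma ideal_mul_carrier:
  assumes "I \<subseteq> carrier M" "J \<subseteq> carrier M"
  shows "{x \<cdot> y | x y. x \<in> I \<and> y \<in> J} \<subseteq> carrier M"
  using assms mul_closed by blast

lemma Idl_mul_closed:
  assumes "I \<in> ideals M" "J \<in> ideals M"
  shows "I \<cdot>\<^bsub>Idl M\<^esub> J \<in> ideals M"
proof -
  have "{x \<cdot> y | x y. x \<in> I \<and> y \<in> J} \<noteq> {}"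
    using assms[THEN ideal_nonempty] by blast
  then show ?thesis
    using down_ideal ideal_mul_carrier assms[THEN ideal_subset] by (simp add: Idl_mul)
qed

lemma Idl_mul_subset_iff:
  assumes "I \<subseteq> carrier M" "J \<subseteq> carrier M" "L \<in> ideals M"
  shows "I \<cdot>\<^bsub>Idl M\<^esub> J \<subseteq> L \<longleftrightarrow> (\<forall>x\<in>I. \<forall>y\<in>J. x \<cdot> y \<in> L)"
  unfolding Idl_mul down_subset_iff[OF ideal_mul_carrier[OF assms(1,2)] assms(3)] by blast

lemma Idl_mulI:
  assumes "I \<in> ideals M" "J \<in> ideals M" "x \<in> I" "y \<in> J"
  shows "x \<cdot> y \<in> I \<cdot>\<^bsub>Idl M\<^esub> J"
  using assms Idl_mul_subset_iff[of I J "I \<cdot>\<^bsub>Idl M\<^esub> J"] Idl_mul_closed ideal_subset by blast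

lemma ordered_magma_Idl: "ordered_magma (Idl M)"
proof -
  interpret I: partial_order "Idl M"
    by (rule partial_order_Idl)
  show ?thesis
  proof
    show "I \<cdot>\<^bsub>Idl M\<^esub> J \<sqsubseteq>\<^bsub>Idl M\<^esub> I' \<cdot>\<^bsub>Idl M\<^esub> J'"
      if "I \<in> carrier (Idl M)" "I' \<in> carrier (Idl M)" "J \<in> carrier (Idl M)" "J' \<in> carrier (Idl M)"
        "I \<sqsubseteq>\<^bsub>Idl M\<^esub> I'" "J \<sqsubseteq>\<^bsub>Idl M\<^esub> J'" for I I' J J'
    proof -
      have "I \<subseteq> carrier M" "J \<subseteq> carrier M" "I' \<cdot>\<^bsub>Idl M\<^esub> J' \<in> ideals M"
        using that Idl_mul_closed by (simp_all add: ideal_subset)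
      moreover have "x \<cdot> y \<in> I' \<cdot>\<^bsub>Idl M\<^esub> J'" if "x \<in> I" "y \<in> J" for x y
        using \<open>I' \<in> _\<close> \<open>J' \<in> _\<close> \<open>I \<sqsubseteq>\<^bsub>Idl M\<^esub> I'\<close> \<open>J \<sqsubseteq>\<^bsub>Idl M\<^esub> J'\<close> that
        by (intro Idl_mulI) auto
      ultimately show ?thesis
        using Idl_mul_subset_iff by simp
    qed
  qed (use Idl_mul_closed in simp)
qed

lemma ideal_generated_carrier:
  "\<X> \<subseteq> ideals M \<Longrightarrow> insert (\<Squnion> {}) (\<Union> \<X>) \<subseteq> carrier M"
  using bot_closed ideal_subset by blast

text \<open>Inserting \<open>\<Squnion> {}\<close> keeps the generating set nonempty, which matters
  for the empty family; it adds nothing else because every ideal contains the least element.\<close>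

lemma is_sup_Idl:
  assumes X: "\<X> \<subseteq> ideals M"
  shows "is_sup (Idl M) (down M (insert (\<Squnion> {}) (\<Union> \<X>))) \<X>"
proof -
  note c = ideal_generated_carrier[OF X]
  have "down M (insert (\<Squnion> {}) (\<Union> \<X>)) \<subseteq> L" if "L \<in> ideals M" "\<forall>I\<in>\<X>. I \<subseteq> L" for L
    using that down_subset_iff[OF c] ideal_bot by blast
  moreover have "I \<subseteq> down M (insert (\<Squnion> {}) (\<Union> \<X>))" if "I \<in> \<X>" for I
    using that subset_down[OF c] by blast
  ultimately show ?thesis
    using down_ideal[OF c] X by (simp add: is_sup_iff)
qed

lemma sup_Idl: "\<X> \<subseteq> ideals M \<Longrightarrow> \<Squnion>\<^bsub>Idl M\<^esub> \<X> = down M (insert (\<Squnion> {}) (\<Union> \<X>))"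
  by (rule partial_order.sup_eqI[OF partial_order_Idl is_sup_Idl])

text \<open>Monotonicity of the product shows that \<open>I\<close> times the supremum bounds the
  products with the members. That it is the least bound is checked on the generators of the supremum
  and extended by \<open>down_mul_subset\<close>.\<close>

lemma prequantale_Idl: "prequantale (Idl M)"
proof -
  interpret I: ordered_magma "Idl M"
    by (rule ordered_magma_Idl)
  have main: "is_sup (Idl M) (I \<cdot>\<^bsub>Idl M\<^esub> (\<Squnion>\<^bsub>Idl M\<^esub> \<X>)) ((\<lambda>J. I \<cdot>\<^bsub>Idl M\<^esub> J) ` \<X>)"
    "is_sup (Idl M) ((\<Squnion>\<^bsub>Idl M\<^esub> \<X>) \<cdot>\<^bsub>Idl M\<^esub> I) ((\<lambda>J. J \<cdot>\<^bsub>Idl M\<^esub> I) ` \<X>)"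
    if I: "I \<in> ideals M" and X: "\<X> \<subseteq> ideals M" for I \<X>
  proof -
    define S where "S = \<Squnion>\<^bsub>Idl M\<^esub> \<X>"
    note c = ideal_generated_carrier[OF X]
    have S_eq: "S = down M (insert (\<Squnion> {}) (\<Union> \<X>))"
      using sup_Idl[OF X] by (simp add: S_def)
    have S: "S \<in> ideals M"
      using down_ideal[OF c] S_eq by simp
    have JS: "J \<subseteq> S" if "J \<in> \<X>" for J
      using subset_down[OF c] that S_eq by blast
    \<comment> \<open>\<open>I\<close> acts as its own generating set, so
      \<open>down_mul_subset\<close> applies with the supremum as the other factor.\<close>
    have ID: "I \<subseteq> down M I"
      using subset_down ideal_subset[OF I] by blast
    note mc = Idl_mul_closed[OF I S] Idl_mul_closed[OF S I]
    have up: "I \<cdot>\<^bsub>Idl M\<^esub> J \<subseteq> I \<cdot>\<^bsub>Idl M\<^esub> S" "J \<cdot>\<^bsub>Idl M\<^esub> I \<subseteq> S \<cdot>\<^bsub>Idl M\<^esub> I" if "J \<in> \<X>" for J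
      using I.mul_mono[of I I J S] I.mul_mono[of J S I I] that JS[OF that] I S X
      by auto
    have lub: "I \<cdot>\<^bsub>Idl M\<^esub> S \<subseteq> L" if L: "L \<in> ideals M" "\<And>J. J \<in> \<X> \<Longrightarrow> I \<cdot>\<^bsub>Idl M\<^esub> J \<subseteq> L" for L
    proof -
      \<comment> \<open>Besides the members of the family, the least element is a generator; its
        products are again least and so lie in every ideal.\<close>
      have gen: "x \<cdot> y \<in> L" if xy: "x \<in> I" "y \<in> insert (\<Squnion> {}) (\<Union> \<X>)" for x y
      proof (cases "y = \<Squnion> {}")
        case True
        then show ?thesis
          using xy(1) ideal_bot[OF L(1)] mul_bot ideal_subset[OF I] by auto
      next
        case False
        then obtain J where "J \<in> \<X>" "y \<in> J"
          using xy(2) by blast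
        then show ?thesis
          using Idl_mulI[OF I, of J x y] xy(1) L(2) X by blast
      qed
      have "x \<cdot> y \<in> L" if "x \<in> I" "y \<in> S" for x y
        using down_mul_subset[OF ideal_subset[OF I] c L(1) gen subsetD[OF ID that(1)]] that(2) S_eq
        by simp
      then show ?thesis
        using Idl_mul_subset_iff[OF ideal_subset[OF I] ideal_subset[OF S] L(1)] by blast
    qed
    have lub': "S \<cdot>\<^bsub>Idl M\<^esub> I \<subseteq> L" if L: "L \<in> ideals M" "\<And>J. J \<in> \<X> \<Longrightarrow> J \<cdot>\<^bsub>Idl M\<^esub> I \<subseteq> L" for L
    proof -
      have gen: "y \<cdot> x \<in> L" if xy: "x \<in> I" "y \<in> insert (\<Squnion> {}) (\<Union> \<X>)" for x y
      proof (cases "y = \<Squnion> {}")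
        case True
        then show ?thesis
          using xy(1) ideal_bot[OF L(1)] bot_mul ideal_subset[OF I] by auto
      next
        case False
        then obtain J where "J \<in> \<X>" "y \<in> J"
          using xy(2) by blast
        then show ?thesis
          using Idl_mulI[OF _ I, of J y x] xy(1) L(2) X by blast
      qed
      have "y \<cdot> x \<in> L" if "x \<in> I" "y \<in> S" for x y
        using down_mul_subset[OF c ideal_subset[OF I] L(1) gen _ subsetD[OF ID that(1)]] that(2) S_eq
        by simp
      then show ?thesis
        using Idl_mul_subset_iff[OF ideal_subset[OF S] ideal_subset[OF I] L(1)] by blast
    qed
    have sub: "(\<lambda>J. I \<cdot>\<^bsub>Idl M\<^esub> J) ` \<X> \<subseteq> carrier (Idl M)" "(\<lambda>J. J \<cdot>\<^bsub>Idl M\<^esub> I) ` \<X> \<subseteq> carrier (Idl M)"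
      using Idl_mul_closed I X by auto
    show "is_sup (Idl M) (I \<cdot>\<^bsub>Idl M\<^esub> (\<Squnion>\<^bsub>Idl M\<^esub> \<X>)) ((\<lambda>J. I \<cdot>\<^bsub>Idl M\<^esub> J) ` \<X>)"
      "is_sup (Idl M) ((\<Squnion>\<^bsub>Idl M\<^esub> \<X>) \<cdot>\<^bsub>Idl M\<^esub> I) ((\<lambda>J. J \<cdot>\<^bsub>Idl M\<^esub> I) ` \<X>)"
      unfolding S_def[symmetric] is_sup_iff[OF sub(1)] is_sup_iff[OF sub(2)] Idl_simps
      by (intro conjI ballI impI mc lub lub'; use up in blast)+
  qed
  show ?thesis
  proof
    show "\<exists>s. is_sup (Idl M) s \<X>" if "\<X> \<subseteq> carrier (Idl M)" for \<X>
      using is_sup_Idl[of \<X>] that by auto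
    show "I \<cdot>\<^bsub>Idl M\<^esub> (\<Squnion>\<^bsub>Idl M\<^esub> \<X>) = \<Squnion>\<^bsub>Idl M\<^esub> ((\<lambda>J. I \<cdot>\<^bsub>Idl M\<^esub> J) ` \<X>)"
      if "I \<in> carrier (Idl M)" "\<X> \<subseteq> carrier (Idl M)" for I \<X>
      by (rule I.sup_eqI[OF main(1), symmetric]) (use that in simp_all)
    show "(\<Squnion>\<^bsub>Idl M\<^esub> \<X>) \<cdot>\<^bsub>Idl M\<^esub> I = \<Squnion>\<^bsub>Idl M\<^esub> ((\<lambda>J. J \<cdot>\<^bsub>Idl M\<^esub> I) ` \<X>)"
      if "I \<in> carrier (Idl M)" "\<X> \<subseteq> carrier (Idl M)" for I \<X>
      by (rule I.sup_eqI[OF main(2), symmetric]) (use that in simp_all)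
  qed
qed

end

section \<open>Principal ideals\<close>

abbreviation principal_of :: "('a, 'r) gorder_scheme \<Rightarrow> 'a \<Rightarrow> 'a set" where
  "principal_of S x \<equiv> {y \<in> carrier S. y \<sqsubseteq>\<^bsub>S\<^esub> x}"

context prequantic_semilattice
begin

lemma principal_ideal: "x \<in> carrier M \<Longrightarrow> principal_of M x \<in> ideals M"
  by (rule idealI) (auto simp: bot_closed bot_least join_le intro: le_trans)

lemma principal_subset_iff:
  assumes "I \<in> ideals M" "x \<in> carrier M"
  shows "principal_of M x \<subseteq> I \<longleftrightarrow> x \<in> I"
  using ideal_downward[OF assms(1)] assms(2) by blast

lemma principal_le_iff:
  "\<lbrakk>x \<in> carrier M; y \<in> carrier M\<rbrakk> \<Longrightarrow> principal_of M x \<subseteq> principal_of M y \<longleftrightarrow> x \<sqsubseteq> y"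
  using principal_subset_iff[OF principal_ideal[of y], of x] by simp

text \<open>Directedness of \<open>I\<close> carries over along
  \<open>x \<mapsto> principal_of M x\<close>. The family serves twice: it forces a compact ideal to
  be principal, and it exhibits every ideal as a supremum of compact ones.\<close>

lemma directed_principals:
  assumes I: "I \<in> ideals M"
  shows "directed_in (Idl M) (principal_of M ` I)" "is_sup (Idl M) I (principal_of M ` I)"
proof -
  note IM = ideal_subset[OF I]
  have sub: "principal_of M ` I \<subseteq> carrier (Idl M)"
    using IM principal_ideal by auto
  have "\<exists>u\<in>principal_of M ` I. \<forall>x\<in>F. x \<subseteq> u" if F: "finite F" "F \<subseteq> principal_of M ` I" for F
  proof -
    obtain G where G: "finite G" "G \<subseteq> I" "F = principal_of M ` G"
      using finite_subset_image[OF F] by blast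
    have dir: "directed_in M I"
      using I by (simp add: ideals_def)
    obtain u where u: "u \<in> I" "\<forall>x\<in>G. x \<sqsubseteq> u"
      using directed_bound[OF dir G(1,2)] by blast
    have "principal_of M x \<subseteq> principal_of M u" if "x \<in> G" for x
      using principal_le_iff u IM G(2) that by blast
    then show ?thesis
      using u(1) unfolding G(3) by blast
  qed
  then show "directed_in (Idl M) (principal_of M ` I)"
    using sub ideal_nonempty[OF I] by (simp add: directed_in_def)
  have "x \<in> principal_of M x" if "x \<in> I" for x
    using that IM by auto
  then have "I \<subseteq> L" if "\<forall>P\<in>principal_of M ` I. P \<subseteq> L" for L
    using that by blast
  moreover have "P \<subseteq> I" if "P \<in> principal_of M ` I" for P
    using that principal_subset_iff[OF I] IM by auto
  ultimately show "is_sup (Idl M) I (principal_of M ` I)"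
    using I by (simp add: is_sup_iff[OF sub])
qed

text \<open>Two elements of the union come from two members of \<open>D\<close>; both lie in a
  common upper bound of these members, and there the join can be formed.\<close>

lemma directed_Union_ideal:
  assumes D: "directed_in (Idl M) D"
  shows "\<Union> D \<in> ideals M"
proof (rule idealI)
  have DI: "D \<subseteq> ideals M" "D \<noteq> {}"
    using D by (simp_all add: directed_in_def)
  show "\<Union> D \<subseteq> carrier M"
    using DI(1) ideal_subset[of _ M] by blast
  show "\<Squnion> {} \<in> \<Union> D"
    using DI ideal_bot by blast
  show "x \<squnion> y \<in> \<Union> D" if "x \<in> \<Union> D" "y \<in> \<Union> D" for x y
  proof -
    obtain I J where IJ: "I \<in> D" "J \<in> D" "x \<in> I" "y \<in> J"
      using \<open>x \<in> \<Union> D\<close> \<open>y \<in> \<Union> D\<close> by blast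
    then obtain L where L: "L \<in> D" "I \<subseteq> L" "J \<subseteq> L"
      using directed_bound[OF D, of "{I, J}"] by auto
    have "L \<in> ideals M" "x \<in> L" "y \<in> L"
      using L IJ DI(1) by blast+
    then show ?thesis
      using ideal_join L(1) by blast
  qed
  show "y \<in> \<Union> D" if "x \<in> \<Union> D" "y \<in> carrier M" "y \<sqsubseteq> x" for x y
    using that DI(1) ideal_downward[of _ M x y] by blast
qed

lemma compact_elements_Idl: "compact_elements (Idl M) = principal_of M ` carrier M"
proof (intro equalityI subsetI)
  fix I assume I: "I \<in> compact_elements (Idl M)"
  then have II: "I \<in> ideals M"
    using compact_carrier[of I "Idl M"] by simp
  \<comment> \<open>Compactness of \<open>I\<close> is tested against the principal ideals of its
    own members, a directed family with supremum \<open>I\<close>.\<close>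
  obtain P where P: "P \<in> principal_of M ` I" "I \<subseteq> P"
    using compact_elementsD[OF I directed_principals[OF II]] by auto
  then obtain x where x: "x \<in> I" "P = principal_of M x"
    by blast
  then have "I = principal_of M x"
    using P(2) principal_subset_iff[OF II] ideal_subset[OF II] by blast
  then show "I \<in> principal_of M ` carrier M"
    using x(1) ideal_subset[OF II] by blast
next
  fix I assume "I \<in> principal_of M ` carrier M"
  then obtain x where x: "x \<in> carrier M" "I = principal_of M x"
    by blast
  show "I \<in> compact_elements (Idl M)"
  proof (rule compact_elementsI)
    show "I \<in> carrier (Idl M)"
      using principal_ideal x by simp
    fix D s assume D: "directed_in (Idl M) D" and s: "is_sup (Idl M) s D" and le: "I \<sqsubseteq>\<^bsub>Idl M\<^esub> s"
    have DI: "D \<subseteq> carrier (Idl M)"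
      using D by (simp add: directed_in_def)
    \<comment> \<open>The union is an ideal above every member of \<open>D\<close>, so the supremum
      lies inside it: directed suprema of ideals are plain unions.\<close>
    have "s \<subseteq> \<Union> D"
      using s directed_Union_ideal[OF D] unfolding is_sup_iff[OF DI] Idl_simps by blast
    moreover have "x \<in> I"
      using x by simp
    ultimately obtain J where J: "J \<in> D" "x \<in> J"
      using le by auto
    then have "I \<subseteq> J"
      using principal_subset_iff[of J x] DI x by auto
    then show "\<exists>J\<in>D. I \<sqsubseteq>\<^bsub>Idl M\<^esub> J"
      using J(1) by auto
  qed
qed

lemma principal_mul:
  assumes x: "x \<in> carrier M" and y: "y \<in> carrier M"
  shows "principal_of M (x \<cdot> y) = principal_of M x \<cdot>\<^bsub>Idl M\<^esub> principal_of M y"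
proof
  note px = principal_ideal[OF x] and py = principal_ideal[OF y]
  have "x \<cdot> y \<in> principal_of M x \<cdot>\<^bsub>Idl M\<^esub> principal_of M y"
    using Idl_mulI[OF px py, of x y] x y by simp
  then show "principal_of M (x \<cdot> y) \<subseteq> principal_of M x \<cdot>\<^bsub>Idl M\<^esub> principal_of M y"
    using principal_subset_iff[OF Idl_mul_closed[OF px py]] mul_closed x y by blast
  show "principal_of M x \<cdot>\<^bsub>Idl M\<^esub> principal_of M y \<subseteq> principal_of M (x \<cdot> y)"
    unfolding Idl_mul_subset_iff[OF ideal_subset[OF px] ideal_subset[OF py]
        principal_ideal[OF mul_closed[OF x y]]]
    using mul_closed mul_mono x y by simp
qed

lemma precoherent_prequantale_Idl: "precoherent_prequantale (Idl M)"
proof -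
  have "\<exists>X. X \<subseteq> compact_elements (Idl M) \<and> is_sup (Idl M) I X" if "I \<in> carrier (Idl M)" for I
  proof (intro exI conjI)
    show "is_sup (Idl M) I (principal_of M ` I)"
      using directed_principals that by simp
    show "principal_of M ` I \<subseteq> compact_elements (Idl M)"
      unfolding compact_elements_Idl using ideal_subset[of I M] that by auto
  qed
  moreover have "I \<cdot>\<^bsub>Idl M\<^esub> J \<in> compact_elements (Idl M)"
    if IJ: "I \<in> compact_elements (Idl M)" "J \<in> compact_elements (Idl M)" for I J
  proof -
    obtain x y where xy: "x \<in> carrier M" "y \<in> carrier M" "I = principal_of M x" "J = principal_of M y"
      using IJ unfolding compact_elements_Idl by blast
    then have "I \<cdot>\<^bsub>Idl M\<^esub> J = principal_of M (x \<cdot> y)"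
      using principal_mul by simp
    then show ?thesis
      using mul_closed[OF xy(1,2)] unfolding compact_elements_Idl by blast
  qed
  ultimately show ?thesis
    by (simp add: precoherent_prequantale_def precoherent_def prequantale_Idl ordered_magma_Idl)
qed

lemma prequantic_semilattice_K_Idl: "prequantic_semilattice (K (Idl M))"
  using precoherent_prequantale_Idl precoherent_prequantale_loc.prequantic_semilattice_K
  by (auto simp: precoherent_prequantale_loc_iff)

lemma K_Idl_unit_apply: "x \<in> carrier M \<Longrightarrow> K_Idl_unit M x = principal_of M x"
  by (simp add: K_Idl_unit_def)

text \<open>Injectivity follows from antisymmetry because principal ideals reflect the order;
  surjectivity is the description of the compact ideals.\<close>

lemma omagma_iso_K_Idl_unit: "omagma_iso M (K (Idl M)) (K_Idl_unit M)"
proof -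
  have "inj_on (principal_of M) (carrier M)"
  proof (rule inj_onI)
    fix x y assume xy: "x \<in> carrier M" "y \<in> carrier M" "principal_of M x = principal_of M y"
    show "x = y"
      using principal_le_iff[of x y] principal_le_iff[of y x] xy by (intro le_antisym) simp_all
  qed
  then have "bij_betw (principal_of M) (carrier M) (compact_elements (Idl M))"
    by (simp add: bij_betw_def compact_elements_Idl)
  then have "omagma_iso M (K (Idl M)) (principal_of M)"
    using principal_le_iff principal_mul by (simp add: omagma_iso_def)
  then show ?thesis
    by (rule omagma_iso_cong[OF _ ordered_magma_axioms K_Idl_unit_apply])
qed

end

lemma down_mono:
  assumes "X \<subseteq> Y"
  shows "down S X \<subseteq> down S Y"
proof
  fix y assume "y \<in> down S X"
  then obtain T where T: "y \<in> carrier S" "finite T" "T \<noteq> {}" "T \<subseteq> X" "y \<sqsubseteq>\<^bsub>S\<^esub> \<Squnion>\<^bsub>S\<^esub> T"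
    unfolding down_def by blast
  then show "y \<in> down S Y"
    using subset_trans[OF T(4) assms] unfolding down_def by blast
qed

section \<open>The functor \<open>Idl\<close> on morphisms\<close>

locale prequantic_semilattice_hom = M: prequantic_semilattice M + M': prequantic_semilattice M'
  for M :: "'a omagma" and M' :: "'b omagma" and g :: "'a \<Rightarrow> 'b" +
  assumes morphism: "prequantic_semilattice_morphism M M' g"
begin

lemma
  shows hom_closed: "x \<in> carrier M \<Longrightarrow> g x \<in> carrier M'"
    and hom_mul: "\<lbrakk>x \<in> carrier M; y \<in> carrier M\<rbrakk> \<Longrightarrow> g (x \<cdot>\<^bsub>M\<^esub> y) = g x \<cdot>\<^bsub>M'\<^esub> g y"
    and hom_bot: "g (\<Squnion>\<^bsub>M\<^esub> {}) = \<Squnion>\<^bsub>M'\<^esub> {}"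
    and hom_join: "\<lbrakk>x \<in> carrier M; y \<in> carrier M\<rbrakk> \<Longrightarrow> g (x \<squnion>\<^bsub>M\<^esub> y) = g x \<squnion>\<^bsub>M'\<^esub> g y"
proof -
  have sup: "g (\<Squnion>\<^bsub>M\<^esub> X) = \<Squnion>\<^bsub>M'\<^esub> (g ` X)" if "finite X" "X \<subseteq> carrier M" for X
    using morphism that by (simp add: prequantic_semilattice_morphism_def)
  have "magma_hom M M' g"
    using morphism by (simp add: prequantic_semilattice_morphism_def)
  then show "x \<in> carrier M \<Longrightarrow> g x \<in> carrier M'"
    and "\<lbrakk>x \<in> carrier M; y \<in> carrier M\<rbrakk> \<Longrightarrow> g (x \<cdot>\<^bsub>M\<^esub> y) = g x \<cdot>\<^bsub>M'\<^esub> g y"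
    by (auto simp: magma_hom_def)
  show "g (\<Squnion>\<^bsub>M\<^esub> {}) = \<Squnion>\<^bsub>M'\<^esub> {}"
    using sup[of "{}"] by simp
  show "\<lbrakk>x \<in> carrier M; y \<in> carrier M\<rbrakk> \<Longrightarrow> g (x \<squnion>\<^bsub>M\<^esub> y) = g x \<squnion>\<^bsub>M'\<^esub> g y"
    using sup[of "{x, y}"] by (simp add: join_def)
qed

text \<open>The relation \<open>x \<sqsubseteq> y\<close> amounts to the equation
  \<open>x \<squnion> y = y\<close>, which \<open>g\<close> preserves.\<close>

lemma hom_mono:
  assumes "x \<in> carrier M" "y \<in> carrier M" "x \<sqsubseteq>\<^bsub>M\<^esub> y"
  shows "g x \<sqsubseteq>\<^bsub>M'\<^esub> g y"
proof -
  have "x \<squnion>\<^bsub>M\<^esub> y = y"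
    using assms by (intro M.le_antisym M.join_le M.join_right) simp_all
  then show ?thesis
    using hom_join[OF assms(1,2)] M'.join_left[of "g x" "g y"] hom_closed assms by simp
qed

text \<open>\<open>g\<close> respects the least element, binary joins and the order, one for each
  closure property of an ideal.\<close>

lemma preimage_ideal:
  assumes L: "L \<in> ideals M'"
  shows "{x \<in> carrier M. g x \<in> L} \<in> ideals M"
proof (rule M.idealI)
  show "y \<in> {x \<in> carrier M. g x \<in> L}"
    if "x \<in> {x \<in> carrier M. g x \<in> L}" "y \<in> carrier M" "y \<sqsubseteq>\<^bsub>M\<^esub> x" for x y
    using that ideal_downward[OF L, of "g x" "g y"] hom_mono hom_closed by simp
qed (auto simp: hom_bot hom_join M.bot_closed M'.ideal_bot[OF L] M'.ideal_join[OF L])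

lemma image_carrier: "X \<subseteq> carrier M \<Longrightarrow> g ` X \<subseteq> carrier M'"
  by (auto simp: hom_closed)

text \<open>The preimage of the right-hand ideal is an ideal containing \<open>X\<close>, hence it
  contains \<open>down M X\<close>. This computes \<open>Idl_map\<close> on generated ideals and is
  the tool for products, suprema and composites.\<close>

lemma down_image_down:
  assumes X: "X \<subseteq> carrier M" "X \<noteq> {}"
  shows "down M' (g ` down M X) = down M' (g ` X)"
proof -
  have XD: "X \<subseteq> down M X" "down M X \<subseteq> carrier M"
    using M.subset_down[OF X(1)] by (auto simp: down_def)
  have L: "down M' (g ` X) \<in> ideals M'"
    using M'.down_ideal image_carrier X by simp
  have "X \<subseteq> {x \<in> carrier M. g x \<in> down M' (g ` X)}"
    using X(1) M'.subset_down[OF image_carrier[OF X(1)]] by blast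
  from M.down_least[OF this preimage_ideal[OF L]]
  have "g ` down M X \<subseteq> down M' (g ` X)"
    by blast
  then have "down M' (g ` down M X) \<subseteq> down M' (g ` X)"
    by (rule M'.down_least[OF _ L])
  moreover have "down M' (g ` X) \<subseteq> down M' (g ` down M X)"
    by (rule down_mono[OF image_mono[OF XD(1)]])
  ultimately show ?thesis
    by blast
qed

lemma Idl_map_apply: "I \<in> ideals M \<Longrightarrow> Idl_map M M' g I = down M' (g ` I)"
  by (simp add: Idl_map_def)

lemma Idl_map_ideal: "I \<in> ideals M \<Longrightarrow> Idl_map M M' g I \<in> ideals M'"
  using M'.down_ideal image_carrier ideal_subset[of I M] ideal_nonempty[of I M]
  by (simp add: Idl_map_apply)

lemma Idl_map_subset_iff:
  assumes "I \<in> ideals M" "L \<in> ideals M'"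
  shows "Idl_map M M' g I \<subseteq> L \<longleftrightarrow> g ` I \<subseteq> L"
  using assms M'.down_subset_iff image_carrier ideal_subset[of I M] by (simp add: Idl_map_apply)

text \<open>By monotonicity \<open>g x\<close> is the largest element of the image of the principal
  ideal. This gives both preservation of compactness and naturality of
  \<open>K_Idl_unit\<close>.\<close>

lemma Idl_map_principal:
  assumes x: "x \<in> carrier M"
  shows "Idl_map M M' g (principal_of M x) = principal_of M' (g x)"
proof
  note px = M.principal_ideal[OF x] and gx = hom_closed[OF x]
  show "Idl_map M M' g (principal_of M x) \<subseteq> principal_of M' (g x)"
    unfolding Idl_map_subset_iff[OF px M'.principal_ideal[OF gx]] using hom_mono x hom_closed by auto
  have "g x \<in> g ` principal_of M x"
    using x by simp
  also have "\<dots> \<subseteq> Idl_map M M' g (principal_of M x)"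
    using Idl_map_subset_iff[OF px Idl_map_ideal[OF px]] by simp
  finally show "principal_of M' (g x) \<subseteq> Idl_map M M' g (principal_of M x)"
    using M'.principal_subset_iff[OF Idl_map_ideal[OF px] gx] by simp
qed

text \<open>Both sides are shown to be the ideal generated by the image of \<open>P\<close>, the set
  of products of members of \<open>I\<close> and \<open>J\<close>.\<close>

lemma Idl_map_mul:
  assumes I: "I \<in> ideals M" and J: "J \<in> ideals M"
  shows "Idl_map M M' g (I \<cdot>\<^bsub>Idl M\<^esub> J) = Idl_map M M' g I \<cdot>\<^bsub>Idl M'\<^esub> Idl_map M M' g J"
proof
  note IM = ideal_subset[OF I] ideal_subset[OF J]
  define P where "P = {x \<cdot>\<^bsub>M\<^esub> y | x y. x \<in> I \<and> y \<in> J}"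
  have P: "P \<subseteq> carrier M" "P \<noteq> {}"
    using M.ideal_mul_carrier[OF IM] ideal_nonempty[OF I] ideal_nonempty[OF J] by (auto simp: P_def)
  note IJ = M.Idl_mul_closed[OF I J] and gI = Idl_map_ideal[OF I] and gJ = Idl_map_ideal[OF J]
  have L: "Idl_map M M' g (I \<cdot>\<^bsub>Idl M\<^esub> J) = down M' (g ` P)"
    using Idl_map_apply[OF IJ] down_image_down[OF P] by (simp add: Idl_mul P_def)
  have gP: "g ` P \<subseteq> carrier M'"
    by (rule image_carrier[OF P(1)])
  have Lid: "down M' (g ` P) \<in> ideals M'"
    using M'.down_ideal[OF gP] P(2) by simp
  have mem: "g x \<in> Idl_map M M' g I'" if "I' \<in> ideals M" "x \<in> I'" for I' x
    using Idl_map_subset_iff[OF that(1) Idl_map_ideal[OF that(1)]] that(2) by blast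
  have "g ` P \<subseteq> Idl_map M M' g I \<cdot>\<^bsub>Idl M'\<^esub> Idl_map M M' g J"
  proof (clarsimp simp: P_def)
    fix x y assume xy: "x \<in> I" "y \<in> J"
    then have "g (x \<cdot>\<^bsub>M\<^esub> y) = g x \<cdot>\<^bsub>M'\<^esub> g y"
      using hom_mul IM by blast
    then show "g (x \<cdot>\<^bsub>M\<^esub> y) \<in> Idl_map M M' g I \<cdot>\<^bsub>Idl M'\<^esub> Idl_map M M' g J"
      using M'.Idl_mulI[OF gI gJ mem[OF I xy(1)] mem[OF J xy(2)]] by simp
  qed
  then show "Idl_map M M' g (I \<cdot>\<^bsub>Idl M\<^esub> J) \<subseteq> Idl_map M M' g I \<cdot>\<^bsub>Idl M'\<^esub> Idl_map M M' g J"
    unfolding L by (rule M'.down_least[OF _ M'.Idl_mul_closed[OF gI gJ]])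
  \<comment> \<open>Since \<open>g\<close> is multiplicative, products of generators are images of
    products; \<open>down_mul_subset\<close> then extends this to the generated ideals.\<close>
  have gg: "x \<cdot>\<^bsub>M'\<^esub> y \<in> down M' (g ` P)" if xy: "x \<in> g ` I" "y \<in> g ` J" for x y
  proof -
    obtain a b where ab: "a \<in> I" "b \<in> J" "x = g a" "y = g b"
      using xy by blast
    then have "x \<cdot>\<^bsub>M'\<^esub> y = g (a \<cdot>\<^bsub>M\<^esub> b)"
      using hom_mul IM by (simp add: subset_iff)
    moreover have "a \<cdot>\<^bsub>M\<^esub> b \<in> P"
      using ab by (auto simp: P_def)
    ultimately show ?thesis
      using M'.subset_down[OF gP] by auto
  qed
  have "u \<cdot>\<^bsub>M'\<^esub> v \<in> down M' (g ` P)" if "u \<in> Idl_map M M' g I" "v \<in> Idl_map M M' g J" for u v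
    using M'.down_mul_subset[OF image_carrier[OF IM(1)] image_carrier[OF IM(2)] Lid gg] that
    by (simp add: Idl_map_apply I J)
  then show "Idl_map M M' g I \<cdot>\<^bsub>Idl M'\<^esub> Idl_map M M' g J \<subseteq> Idl_map M M' g (I \<cdot>\<^bsub>Idl M\<^esub> J)"
    unfolding L M'.Idl_mul_subset_iff[OF ideal_subset[OF gI] ideal_subset[OF gJ] Lid] by blast
qed

text \<open>An ideal \<open>L\<close> above all the image ideals contains the image of the union,
  and it contains the image of the extra generator because \<open>g\<close> sends least element to
  least element. Hence it contains the ideal generated by both.\<close>

lemma Idl_map_sup:
  assumes X: "\<X> \<subseteq> ideals M"
  shows "Idl_map M M' g (\<Squnion>\<^bsub>Idl M\<^esub> \<X>) = \<Squnion>\<^bsub>Idl M'\<^esub> (Idl_map M M' g ` \<X>)"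
proof -
  let ?S = "\<Squnion>\<^bsub>Idl M\<^esub> \<X>" and ?G = "insert (\<Squnion>\<^bsub>M\<^esub> {}) (\<Union> \<X>)"
  note G = M.ideal_generated_carrier[OF X]
  have S: "?S = down M ?G" "?S \<in> ideals M"
    using M.sup_Idl[OF X] M.down_ideal[OF G] by auto
  have gX: "Idl_map M M' g ` \<X> \<subseteq> carrier (Idl M')"
    using Idl_map_ideal X by auto
  have gS: "Idl_map M M' g ?S = down M' (g ` ?G)"
    using Idl_map_apply[OF S(2)] down_image_down[OF G] S(1) by simp
  have "Idl_map M M' g I \<subseteq> Idl_map M M' g ?S" if I: "I \<in> \<X>" for I
  proof -
    have "g ` I \<subseteq> g ` ?G"
      using I by blast
    also have "\<dots> \<subseteq> Idl_map M M' g ?S"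
      unfolding gS by (rule M'.subset_down[OF image_carrier[OF G]])
    finally show ?thesis
      using Idl_map_subset_iff[OF _ Idl_map_ideal[OF S(2)]] I X by blast
  qed
  moreover have "Idl_map M M' g ?S \<subseteq> L" if L: "L \<in> ideals M'" "\<forall>I\<in>\<X>. Idl_map M M' g I \<subseteq> L" for L
  proof -
    have "g ` I \<subseteq> L" if "I \<in> \<X>" for I
      using L(2) Idl_map_subset_iff[OF _ L(1)] that X by blast
    then have "g ` ?G \<subseteq> L"
      using hom_bot M'.ideal_bot[OF L(1)] by auto
    then show ?thesis
      unfolding gS by (rule M'.down_least[OF _ L(1)])
  qed
  ultimately have "is_sup (Idl M') (Idl_map M M' g ?S) (Idl_map M M' g ` \<X>)"
    unfolding is_sup_iff[OF gX] using Idl_map_ideal[OF S(2)] by simp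
  then show ?thesis
    by (rule partial_order.sup_eqI[OF partial_order_Idl, symmetric])
qed

lemma precoherent_prequantale_morphism_Idl_map:
  "precoherent_prequantale_morphism (Idl M) (Idl M') (Idl_map M M' g)"
proof -
  have "Idl_map M M' g I \<in> compact_elements (Idl M')" if "I \<in> compact_elements (Idl M)" for I
    using that hom_closed Idl_map_principal
    unfolding M.compact_elements_Idl M'.compact_elements_Idl by auto
  moreover have "magma_hom (Idl M) (Idl M') (Idl_map M M' g)"
    using Idl_map_ideal Idl_map_mul by (simp add: magma_hom_def)
  ultimately show ?thesis
    using Idl_map_sup
    by (auto simp: precoherent_prequantale_morphism_def prequantale_morphism_def
        M.prequantale_Idl M'.prequantale_Idl M.precoherent_prequantale_Idl
        M'.precoherent_prequantale_Idl)
qed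

lemma K_Idl_unit_natural:
  assumes x: "x \<in> carrier M"
  shows "K_Idl_unit M' (g x) = K_map (Idl M) (Idl_map M M' g) (K_Idl_unit M x)"
proof -
  have "principal_of M x \<in> compact_elements (Idl M)"
    using x by (simp add: M.compact_elements_Idl)
  then show ?thesis
    by (simp add: x hom_closed M.K_Idl_unit_apply M'.K_Idl_unit_apply K_map_apply Idl_map_principal)
qed

end

section \<open>Identity and composition laws for \<open>Idl\<close> and \<open>K\<close>\<close>

lemma prequantic_semilattice_homI:
  "prequantic_semilattice_morphism M M' g \<Longrightarrow> prequantic_semilattice_hom M M' g"
  by (simp add: prequantic_semilattice_hom_def prequantic_semilattice_hom_axioms_def
      prequantic_semilattice_morphism_def)

lemma (in prequantic_semilattice) down_of_ideal: "I \<in> ideals M \<Longrightarrow> down M I = I"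
  using down_least[of I I] subset_down[of I] ideal_subset[of I M] by blast

lemma Idl_map_id:
  assumes "prequantic_semilattice M"
  shows "Idl_map M M (\<lambda>x\<in>carrier M. x) = (\<lambda>I\<in>carrier (Idl M). I)"
proof -
  interpret prequantic_semilattice M by fact
  have "(\<lambda>x\<in>carrier M. x) ` I = I" if "I \<in> ideals M" for I
    using ideal_subset[OF that] by force
  then show ?thesis
    by (auto simp: Idl_map_def down_of_ideal fun_eq_iff)
qed

text \<open>The intermediate closure taken in \<open>M'\<close> is absorbed by
  \<open>down_image_down\<close>.\<close>

lemma Idl_map_compose:
  assumes g: "prequantic_semilattice_morphism M M' g"
    and g': "prequantic_semilattice_morphism M' M'' g'"
  shows "Idl_map M M'' (compose (carrier M) g' g)
    = compose (carrier (Idl M)) (Idl_map M' M'' g') (Idl_map M M' g)"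
proof -
  interpret g: prequantic_semilattice_hom M M' g
    using g by (rule prequantic_semilattice_homI)
  interpret g': prequantic_semilattice_hom M' M'' g'
    using g' by (rule prequantic_semilattice_homI)
  have "down M'' (compose (carrier M) g' g ` I) = Idl_map M' M'' g' (Idl_map M M' g I)"
    if I: "I \<in> ideals M" for I
  proof -
    have "compose (carrier M) g' g ` I = g' ` g ` I"
      using ideal_subset[OF I] by (force simp: compose_def image_image)
    moreover have "Idl_map M' M'' g' (Idl_map M M' g I) = down M'' (g' ` down M' (g ` I))"
      using g'.Idl_map_apply[OF g.Idl_map_ideal[OF I]] g.Idl_map_apply[OF I] by simp
    ultimately show ?thesis
      using g'.down_image_down[OF g.image_carrier[OF ideal_subset[OF I]]] ideal_nonempty[OF I]
      by simp
  qed
  then show ?thesis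
    by (auto simp: Idl_map_def compose_def fun_eq_iff)
qed

lemma K_map_id: "K_map Q (\<lambda>x\<in>carrier Q. x) = (\<lambda>x\<in>carrier (K Q). x)"
  using compact_carrier[of _ Q] by (auto simp: K_map_def fun_eq_iff)

text \<open>\<open>f\<close> sends compact elements to compact elements, so
  \<open>K_map Q' f'\<close> is applied only where it agrees with \<open>f'\<close>.\<close>

lemma K_map_compose:
  assumes "precoherent_prequantale_morphism Q Q' f"
  shows "K_map Q (compose (carrier Q) f' f) = compose (carrier (K Q)) (K_map Q' f') (K_map Q f)"
proof -
  have "f x \<in> compact_elements Q'" if "x \<in> compact_elements Q" for x
    using assms that by (auto simp: precoherent_prequantale_morphism_def)
  then show ?thesis
    using compact_carrier[of _ Q] by (auto simp: K_map_def compose_def fun_eq_iff)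
qed

section \<open>The isomorphism of \<open>Q\<close> with \<open>Idl (K Q)\<close>\<close>

context precoherent_prequantale_loc
begin

interpretation K: prequantic_semilattice "K Q"
  by (rule prequantic_semilattice_K)

abbreviation below :: "'a \<Rightarrow> 'a set" where
  "below x \<equiv> {c \<in> compact_elements Q. c \<sqsubseteq> x}"

lemma below_carrier: "below x \<subseteq> carrier Q"
  using compact_carrier[of _ Q] by blast

text \<open>The supremum of finitely many compact elements below \<open>x\<close> is again compact
  and below \<open>x\<close>, so it serves as the bound required by directedness.\<close>

lemma below_ideal:
  assumes x: "x \<in> carrier Q"
  shows "below x \<in> ideals (K Q)"
proof -
  have "\<exists>u\<in>below x. \<forall>c\<in>F. c \<sqsubseteq> u" if F: "finite F" "F \<subseteq> below x" for F
  proof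
    have FQ: "F \<subseteq> carrier Q"
      using F(2) below_carrier by blast
    have "\<Squnion> F \<sqsubseteq> x"
      using sup_le[OF FQ x] F(2) by blast
    moreover have "\<Squnion> F \<in> compact_elements Q"
      using compact_sup[OF F(1)] F(2) by blast
    ultimately show "\<Squnion> F \<in> below x"
      by simp
    show "\<forall>c\<in>F. c \<sqsubseteq> \<Squnion> F"
      using le_sup[OF FQ] by blast
  qed
  \<comment> \<open>The case \<open>F = {}\<close> supplies nonemptiness, the general case supplies
    the bounds.\<close>
  from this[of "{}"] this have "directed_in (K Q) (below x)"
    by (auto simp: directed_in_def)
  moreover have "d \<sqsubseteq> x" if "c \<sqsubseteq> x" "d \<sqsubseteq> c" "c \<in> compact_elements Q" "d \<in> compact_elements Q" for c d
    using le_trans[OF that(2,1)] that(3,4) x by (simp add: compact_carrier)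
  ultimately show ?thesis
    by (auto simp: ideals_def)
qed

text \<open>\<open>K Q\<close> carries the order of \<open>Q\<close>, so directedness transfers to
  \<open>Q\<close>, which is where compactness is tested.\<close>

lemma ideal_K_directed:
  assumes "I \<in> ideals (K Q)"
  shows "directed_in Q I" "I \<subseteq> carrier Q"
  using assms subset_trans[OF _ compact_subset_carrier[of Q], of I]
  by (simp_all add: ideals_def directed_in_def)

text \<open>Some set \<open>X\<close> of compact elements has supremum \<open>x\<close>. It is
  contained in \<open>below x\<close>, so every bound of \<open>below x\<close> is a bound of
  \<open>X\<close>.\<close>

lemma is_sup_below:
  assumes x: "x \<in> carrier Q"
  shows "is_sup Q x (below x)"
proof -
  obtain X where X: "X \<subseteq> compact_elements Q" "is_sup Q x X"
    using compactly_generated[OF x] by blast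
  have XQ: "X \<subseteq> carrier Q"
    by (rule subset_trans[OF X(1) compact_subset_carrier])
  have Xx: "X \<subseteq> below x"
    using X unfolding is_sup_iff[OF XQ] by blast
  have "x \<sqsubseteq> u" if "u \<in> carrier Q" "\<forall>c\<in>below x. c \<sqsubseteq> u" for u
    using X(2) that Xx unfolding is_sup_iff[OF XQ] by blast
  then show ?thesis
    using x by (simp add: is_sup_iff[OF below_carrier])
qed

lemma sup_below: "x \<in> carrier Q \<Longrightarrow> \<Squnion> (below x) = x"
  by (rule sup_eqI[OF is_sup_below])

lemma below_sup:
  assumes I: "I \<in> ideals (K Q)"
  shows "below (\<Squnion> I) = I"
proof
  note dir = ideal_K_directed[OF I]
  have IK: "I \<subseteq> compact_elements Q"
    using ideal_subset[OF I] by simp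
  show "I \<subseteq> below (\<Squnion> I)"
    using le_sup[OF dir(2)] IK by blast
  show "below (\<Squnion> I) \<subseteq> I"
  proof clarify
    fix c assume c: "c \<in> compact_elements Q" "c \<sqsubseteq> \<Squnion> I"
    then obtain d where "d \<in> I" "c \<sqsubseteq> d"
      using compact_elementsD[OF c(1) dir(1) is_sup_sup[OF dir(2)]] by blast
    then show "c \<in> I"
      using ideal_downward[OF I, of d c] c(1) by simp
  qed
qed

lemma below_le_iff:
  assumes x: "x \<in> carrier Q" and y: "y \<in> carrier Q"
  shows "below x \<subseteq> below y \<longleftrightarrow> x \<sqsubseteq> y"
proof
  assume "below x \<subseteq> below y"
  then have "\<Squnion> (below x) \<sqsubseteq> y"
    by (intro sup_le[OF below_carrier y]) blast
  then show "x \<sqsubseteq> y"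
    by (simp add: sup_below x)
next
  assume le: "x \<sqsubseteq> y"
  have "c \<sqsubseteq> y" if "c \<in> compact_elements Q" "c \<sqsubseteq> x" for c
    using le_trans[OF that(2) le] that(1) x y by (simp add: compact_carrier)
  then show "below x \<subseteq> below y"
    by blast
qed

text \<open>For the inclusion into \<open>?P\<close>, both factors are written as suprema of compact
  elements and multiplication is distributed over each in turn. Every product
  \<open>c \<cdot> d\<close> of compact elements lies in \<open>?P\<close>, so
  \<open>x \<cdot> y\<close> is below the supremum of \<open>?P\<close>, and \<open>below\<close>
  recovers \<open>?P\<close> from that supremum.\<close>

lemma below_mul:
  assumes x: "x \<in> carrier Q" and y: "y \<in> carrier Q"
  shows "below (x \<cdot> y) = below x \<cdot>\<^bsub>Idl (K Q)\<^esub> below y"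
proof
  note bx = below_ideal[OF x] and by' = below_ideal[OF y]
  let ?P = "below x \<cdot>\<^bsub>Idl (K Q)\<^esub> below y"
  have P: "?P \<in> ideals (K Q)"
    by (rule K.Idl_mul_closed[OF bx by'])
  note PQ = ideal_K_directed[OF P]
  have s: "\<Squnion> ?P \<in> carrier Q"
    by (rule sup_closed[OF PQ(2)])
  have cd: "c \<cdot> d \<sqsubseteq> \<Squnion> ?P" if "c \<in> below x" "d \<in> below y" for c d
    using le_sup[OF PQ(2)] K.Idl_mulI[OF bx by' that] by simp
  have cy: "c \<cdot> y \<sqsubseteq> \<Squnion> ?P" if c: "c \<in> below x" for c
  proof -
    have cQ: "c \<in> carrier Q"
      using c below_carrier by blast
    have "c \<cdot> y = \<Squnion> ((\<lambda>d. c \<cdot> d) ` below y)"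
      using mul_sup[OF cQ below_carrier[of y]] sup_below[OF y] by simp
    moreover have "\<Squnion> ((\<lambda>d. c \<cdot> d) ` below y) \<sqsubseteq> \<Squnion> ?P"
      using cd[OF c] mul_closed[OF cQ] below_carrier[of y] by (intro sup_le[OF _ s]) auto
    ultimately show ?thesis
      by simp
  qed
  have "x \<cdot> y = \<Squnion> ((\<lambda>c. c \<cdot> y) ` below x)"
    using sup_mul[OF y below_carrier[of x]] sup_below[OF x] by simp
  also have "\<dots> \<sqsubseteq> \<Squnion> ?P"
    using cy mul_closed[OF _ y] below_carrier[of x] by (intro sup_le[OF _ s]) auto
  finally have "below (x \<cdot> y) \<subseteq> below (\<Squnion> ?P)"
    using below_le_iff[OF mul_closed[OF x y] s] by simp
  then show "below (x \<cdot> y) \<subseteq> ?P"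
    by (simp add: below_sup[OF P])
  have "c \<cdot> d \<in> below (x \<cdot> y)" if "c \<in> below x" "d \<in> below y" for c d
    using that compact_mul mul_mono x y by (simp add: compact_carrier)
  then show "?P \<subseteq> below (x \<cdot> y)"
    using K.Idl_mul_subset_iff[OF ideal_subset[OF bx] ideal_subset[OF by']
        below_ideal[OF mul_closed[OF x y]]] by simp
qed

lemma Idl_K_unit_apply: "x \<in> carrier Q \<Longrightarrow> Idl_K_unit Q x = below x"
  by (simp add: Idl_K_unit_def)

lemma omagma_iso_Idl_K_unit: "omagma_iso Q (Idl (K Q)) (Idl_K_unit Q)"
proof -
  have "bij_betw below (carrier Q) (ideals (K Q))"
    by (rule bij_betw_byWitness[where f' = "\<lambda>I. \<Squnion> I"])
      (use sup_below below_sup below_ideal sup_closed[OF ideal_K_directed(2)] in auto)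
  then have "omagma_iso Q (Idl (K Q)) below"
    using below_le_iff below_mul by (simp add: omagma_iso_def)
  then show ?thesis
    by (rule omagma_iso_cong[OF _ ordered_magma_axioms Idl_K_unit_apply])
qed

end

text \<open>Since \<open>f\<close> preserves suprema, \<open>f x\<close> is the supremum of the
  images of \<open>below x\<close>, all of which lie in the ideal \<open>?L\<close>. Thus
  \<open>f x\<close> is below the supremum of \<open>?L\<close>, and \<open>below_sup\<close> turns
  this into an inclusion of ideals.\<close>

lemma Idl_K_unit_natural:
  assumes f: "precoherent_prequantale_morphism Q Q' f" and x: "x \<in> carrier Q"
  shows "Idl_K_unit Q' (f x) = Idl_map (K Q) (K Q') (K_map Q f) (Idl_K_unit Q x)"
proof -
  interpret Q: precoherent_prequantale_loc Q
    using f by (simp add: precoherent_prequantale_morphism_def precoherent_prequantale_loc_iff)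
  interpret Q': precoherent_prequantale_loc Q'
    using f by (simp add: precoherent_prequantale_morphism_def precoherent_prequantale_loc_iff)
  interpret g: prequantic_semilattice_hom "K Q" "K Q'" "K_map Q f"
    using f by (intro prequantic_semilattice_homI prequantic_semilattice_morphism_K_map)
  note bx = Q.below_ideal[OF x]
  have fx: "f x \<in> carrier Q'"
    using f x by (auto simp: precoherent_prequantale_morphism_def prequantale_morphism_def magma_hom_def)
  let ?L = "Idl_map (K Q) (K Q') (K_map Q f) (Q.below x)"
  note L = g.Idl_map_ideal[OF bx]
  note LQ = Q'.ideal_K_directed[OF L]
  have img: "K_map Q f ` Q.below x = f ` Q.below x"
    by (intro image_cong) (auto simp: K_map_apply)
  have sub: "f ` Q.below x \<subseteq> ?L"
    using g.Idl_map_subset_iff[OF bx L] img by simp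
  have "f x = \<Squnion>\<^bsub>Q'\<^esub> (f ` Q.below x)"
    using f Q.below_carrier[of x] Q.sup_below[OF x]
    unfolding precoherent_prequantale_morphism_def prequantale_morphism_def by metis
  also have "\<dots> \<sqsubseteq>\<^bsub>Q'\<^esub> \<Squnion>\<^bsub>Q'\<^esub> ?L"
    using sub LQ(2) Q'.le_sup[OF LQ(2)]
    by (intro Q'.sup_le Q'.sup_closed) blast+
  finally have "Q'.below (f x) \<subseteq> Q'.below (\<Squnion>\<^bsub>Q'\<^esub> ?L)"
    using Q'.below_le_iff[OF fx Q'.sup_closed[OF LQ(2)]] by simp
  then have "Q'.below (f x) \<subseteq> ?L"
    by (simp add: Q'.below_sup[OF L])
  moreover have "f c \<in> Q'.below (f x)" if c: "c \<in> Q.below x" for c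
  proof -
    have fsub: "f ` Q.below x \<subseteq> carrier Q'"
      using sub LQ(2) by blast
    \<comment> \<open>Monotonicity of \<open>f\<close> is read off here from \<open>f x\<close>
      being the supremum of the images.\<close>
    have "f c \<sqsubseteq>\<^bsub>Q'\<^esub> f x"
      unfolding \<open>f x = \<Squnion>\<^bsub>Q'\<^esub> (f ` Q.below x)\<close> using Q'.le_sup[OF fsub] c by blast
    moreover have "f c \<in> compact_elements Q'"
      using f c by (auto simp: precoherent_prequantale_morphism_def)
    ultimately show ?thesis
      by simp
  qed
  then have "?L \<subseteq> Q'.below (f x)"
    unfolding g.Idl_map_subset_iff[OF bx Q'.below_ideal[OF fx]] img by blast
  ultimately show ?thesis
    by (simp add: Q.Idl_K_unit_apply[OF x] Q'.Idl_K_unit_apply[OF fx] subset_antisym)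
qed

section \<open>Composition of morphisms\<close>

lemma magma_hom_compose:
  assumes f: "magma_hom A B f" and g: "magma_hom B C g" and "ordered_magma A"
  shows "magma_hom A C (compose (carrier A) g f)"
proof -
  interpret ordered_magma A by fact
  show ?thesis
    using f g mul_closed by (auto simp: magma_hom_def compose_def Pi_iff)
qed

text \<open>\<open>compose\<close> is undefined off \<open>carrier A\<close>, so the supremum itself
  has to lie in the carrier. The set \<open>X\<close> is fixed, so that the lemma serves arbitrary
  sets for prequantales and finite sets for semilattices.\<close>

lemma sup_compose:
  assumes f: "f (\<Squnion>\<^bsub>A\<^esub> X) = \<Squnion>\<^bsub>B\<^esub> (f ` X)" and g: "g (\<Squnion>\<^bsub>B\<^esub> (f ` X)) = \<Squnion>\<^bsub>C\<^esub> (g ` f ` X)"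
    and X: "X \<subseteq> carrier A" and s: "\<Squnion>\<^bsub>A\<^esub> X \<in> carrier A"
  shows "compose (carrier A) g f (\<Squnion>\<^bsub>A\<^esub> X) = \<Squnion>\<^bsub>C\<^esub> (compose (carrier A) g f ` X)"
proof -
  have "compose (carrier A) g f ` X = g ` f ` X"
    unfolding image_image using X by (intro image_cong) (auto simp: compose_def)
  then show ?thesis
    using s by (simp add: compose_def f g)
qed

lemma precoherent_prequantale_morphism_compose:
  assumes f: "precoherent_prequantale_morphism A B f" and g: "precoherent_prequantale_morphism B C g"
  shows "precoherent_prequantale_morphism A C (compose (carrier A) g f)"
proof -
  interpret A: precoherent_prequantale_loc A
    using f by (simp add: precoherent_prequantale_morphism_def precoherent_prequantale_loc_iff)
  have fh: "magma_hom A B f" "magma_hom B C g" "f ` carrier A \<subseteq> carrier B"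
    using f g by (auto simp: precoherent_prequantale_morphism_def prequantale_morphism_def magma_hom_def)
  have "compose (carrier A) g f (\<Squnion>\<^bsub>A\<^esub> X) = \<Squnion>\<^bsub>C\<^esub> (compose (carrier A) g f ` X)"
    if X: "X \<subseteq> carrier A" for X
  proof (rule sup_compose)
    have "f ` X \<subseteq> carrier B"
      using X fh(3) by blast
    then show "g (\<Squnion>\<^bsub>B\<^esub> (f ` X)) = \<Squnion>\<^bsub>C\<^esub> (g ` f ` X)"
      using g by (simp add: precoherent_prequantale_morphism_def prequantale_morphism_def)
  qed (use f X A.sup_closed in
      \<open>simp_all add: precoherent_prequantale_morphism_def prequantale_morphism_def\<close>)
  moreover have "compose (carrier A) g f x \<in> compact_elements C" if "x \<in> compact_elements A" for x
  proof -
    have "f x \<in> compact_elements B"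
      using f that by (auto simp: precoherent_prequantale_morphism_def)
    then have "g (f x) \<in> compact_elements C"
      using g by (auto simp: precoherent_prequantale_morphism_def)
    then show ?thesis
      using that by (simp add: compose_def compact_carrier)
  qed
  then have "compose (carrier A) g f ` compact_elements A \<subseteq> compact_elements C"
    by blast
  ultimately show ?thesis
    using f g magma_hom_compose[OF fh(1,2) A.ordered_magma_axioms]
    by (simp add: precoherent_prequantale_morphism_def prequantale_morphism_def)
qed

lemma prequantic_semilattice_morphism_compose:
  assumes f: "prequantic_semilattice_morphism A B f" and g: "prequantic_semilattice_morphism B C g"
  shows "prequantic_semilattice_morphism A C (compose (carrier A) g f)"
proof -
  interpret A: prequantic_semilattice A
    using f by (simp add: prequantic_semilattice_morphism_def)
  have fh: "magma_hom A B f" "magma_hom B C g" "f ` carrier A \<subseteq> carrier B"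
    using f g by (auto simp: prequantic_semilattice_morphism_def magma_hom_def)
  have "compose (carrier A) g f (\<Squnion>\<^bsub>A\<^esub> X) = \<Squnion>\<^bsub>C\<^esub> (compose (carrier A) g f ` X)"
    if X: "finite X" "X \<subseteq> carrier A" for X
  proof (rule sup_compose)
    have "f ` X \<subseteq> carrier B"
      using X fh(3) by blast
    then show "g (\<Squnion>\<^bsub>B\<^esub> (f ` X)) = \<Squnion>\<^bsub>C\<^esub> (g ` f ` X)"
      using g X by (simp add: prequantic_semilattice_morphism_def)
  qed (use f X A.finite_sup_in_carrier in \<open>simp_all add: prequantic_semilattice_morphism_def\<close>)
  then show ?thesis
    using f g magma_hom_compose[OF fh(1,2) A.ordered_magma_axioms]
    by (simp add: prequantic_semilattice_morphism_def)
qed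

section \<open>Categories of ordered magmas\<close>

lemma concrete_cat_simps [simp]:
  "A \<in> obj (concrete_cat ob hom) \<longleftrightarrow> ob A"
  "(A, f, B) \<in> arr (concrete_cat ob hom) \<longleftrightarrow>
    ob A \<and> ob B \<and> hom A B f \<and> f \<in> extensional (carrier A)"
  "src (concrete_cat ob hom) (A, f, B) = A"
  "tgt (concrete_cat ob hom) (A, f, B) = B"
  "ide (concrete_cat ob hom) A = (A, \<lambda>x\<in>carrier A. x, A)"
  "cmp (concrete_cat ob hom) (B', g, D) (A, f, B) = (A, compose (carrier A) g f, D)"
  by (simp_all add: concrete_cat_def)

lemma concrete_cat_arrE:
  assumes "a \<in> arr (concrete_cat ob hom)"
  obtains A f B where "a = (A, f, B)" "ob A" "ob B" "hom A B f" "f \<in> extensional (carrier A)"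
  using assms by (cases a) auto

text \<open>The common ground of the two categories. The assumption \<open>hom_iso\<close> supplies
  the identities as well as the invertible arrows.\<close>

locale omagma_cat =
  fixes ob :: "'u omagma \<Rightarrow> bool" and hom :: "'u omagma \<Rightarrow> 'u omagma \<Rightarrow> ('u \<Rightarrow> 'u) \<Rightarrow> bool"
  assumes ob_magma: "ob A \<Longrightarrow> ordered_magma A"
    and hom_closed: "\<lbrakk>hom A B f; x \<in> carrier A\<rbrakk> \<Longrightarrow> f x \<in> carrier B"
    and hom_iso: "\<lbrakk>ob A; ob B; omagma_iso A B h\<rbrakk> \<Longrightarrow> hom A B h"
    and hom_compose: "\<lbrakk>hom A B f; hom B C g\<rbrakk> \<Longrightarrow> hom A C (compose (carrier A) g f)"
begin

abbreviation cat where "cat \<equiv> concrete_cat ob hom"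

lemma omagma_iso_id: "ob A \<Longrightarrow> omagma_iso A A (\<lambda>x\<in>carrier A. x)"
  using ordered_magma.mul_closed[OF ob_magma] by (simp add: omagma_iso_def bij_betw_def inj_on_def)

lemma category: "category cat"
proof
  show "src cat f \<in> obj cat" "tgt cat f \<in> obj cat" if "f \<in> arr cat" for f
    using that by (auto elim!: concrete_cat_arrE)
  show "ide cat A \<in> arr cat \<and> src cat (ide cat A) = A \<and> tgt cat (ide cat A) = A" if "A \<in> obj cat" for A
    using that hom_iso omagma_iso_id by simp
  show "cmp cat g f \<in> arr cat \<and> src cat (cmp cat g f) = src cat f \<and> tgt cat (cmp cat g f) = tgt cat g"
    if "f \<in> arr cat" "g \<in> arr cat" "tgt cat f = src cat g" for f g
    using that hom_compose by (auto elim!: concrete_cat_arrE)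
  show "cmp cat f (ide cat (src cat f)) = f \<and> cmp cat (ide cat (tgt cat f)) f = f" if "f \<in> arr cat" for f
    using that
  proof (rule concrete_cat_arrE)
    fix A h B assume h: "f = (A, h, B)" "hom A B h" "h \<in> extensional (carrier A)"
    \<comment> \<open>Extensionality of \<open>h\<close> is essential: a composite is undefined off
      \<open>carrier A\<close>, so it can equal \<open>h\<close> only if \<open>h\<close> is
      undefined there too.\<close>
    have "compose (carrier A) h (\<lambda>x\<in>carrier A. x) = h"
      "compose (carrier A) (\<lambda>x\<in>carrier B. x) h = h"
      using h hom_closed by (auto simp: compose_def extensional_def)
    then show ?thesis
      using h by simp
  qed
  show "cmp cat h (cmp cat g f) = cmp cat (cmp cat h g) f"
    if "f \<in> arr cat" "g \<in> arr cat" "h \<in> arr cat" "tgt cat f = src cat g" "tgt cat g = src cat h" for f g h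
    using that hom_closed by (auto elim!: concrete_cat_arrE simp: compose_def fun_eq_iff)
qed

lemma iso_arr:
  assumes A: "ob A" and B: "ob B" and h: "omagma_iso A B h" and ext: "h \<in> extensional (carrier A)"
  shows "iso_arr cat (A, h, B)"
proof -
  \<comment> \<open>The inverse is restricted to \<open>carrier B\<close> in order to be an
    arrow.\<close>
  let ?k = "\<lambda>y\<in>carrier B. inv_into (carrier A) h y"
  note kh = omagma_iso_inv_apply[OF h]
  have k: "omagma_iso B A ?k"
    by (rule omagma_iso_cong[OF omagma_iso_inv[OF ob_magma[OF A] h] ob_magma[OF B]]) simp
  have "compose (carrier A) ?k h = (\<lambda>x\<in>carrier A. x)"
    using kh by (auto simp: compose_def fun_eq_iff)
  moreover have "compose (carrier B) h ?k = (\<lambda>x\<in>carrier B. x)"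
    using kh by (auto simp: compose_def fun_eq_iff)
  ultimately show ?thesis
    using assms hom_iso[OF A B h] hom_iso[OF B A k]
    by (auto simp: iso_arr_def intro!: bexI[of _ "(B, ?k, A)"])
qed

end

lemma cat_functor_id: "category C \<Longrightarrow> cat_functor C C (\<lambda>A. A) (\<lambda>f. f)"
  by (simp add: cat_functor_def cat_functor_axioms_def)

lemma cat_functor_comp:
  assumes "cat_functor C D Fo Fa" "cat_functor D E Go Ga"
  shows "cat_functor C E (Go \<circ> Fo) (Ga \<circ> Fa)"
proof -
  interpret F: cat_functor C D Fo Fa by fact
  interpret G: cat_functor D E Go Ga by fact
  show ?thesis
    by unfold_locales
      (simp_all add: F.map_obj F.map_arr F.map_ide F.map_cmp G.map_obj G.map_arr G.map_ide G.map_cmp)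
qed

text \<open>Isomorphisms carry compact elements to compact elements in both directions. This allows
  \<open>Idl M\<close> to be replaced by its encoded copy underneath \<open>K\<close>.\<close>

lemma omagma_iso_K:
  assumes A: "ordered_magma A" and B: "ordered_magma B" and h: "omagma_iso A B h"
  shows "omagma_iso (K A) (K B) h"
proof -
  note kh = omagma_iso_inv_apply[OF h]
  have "compact_elements B \<subseteq> h ` compact_elements A"
  proof
    fix y assume y: "y \<in> compact_elements B"
    have "inv_into (carrier A) h y \<in> compact_elements A"
      by (rule omagma_iso_compact[OF B omagma_iso_inv[OF A h] y])
    then show "y \<in> h ` compact_elements A"
      using kh(2)[OF compact_carrier[OF y]] by (metis imageI)
  qed
  moreover have "h ` compact_elements A \<subseteq> compact_elements B"
    using omagma_iso_compact[OF A h] by auto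
  moreover have "inj_on h (compact_elements A)"
  proof (rule inj_on_subset[OF _ compact_subset_carrier])
    show "inj_on h (carrier A)"
      using h by (simp add: omagma_iso_def bij_betw_def)
  qed
  ultimately have "bij_betw h (compact_elements A) (compact_elements B)"
    by (simp add: bij_betw_def)
  then show ?thesis
    using h by (simp add: omagma_iso_def compact_carrier)
qed

lemma precoherent_prequantale_magma: "precoherent_prequantale Q \<Longrightarrow> ordered_magma Q"
  by (simp add: precoherent_prequantale_def precoherent_def)

lemma K_prequantic_semilattice: "precoherent_prequantale Q \<Longrightarrow> prequantic_semilattice (K Q)"
  by (simp add: precoherent_prequantale_loc_iff precoherent_prequantale_loc.prequantic_semilattice_K)

lemma K_map_extensional: "K_map Q f \<in> extensional (compact_elements Q)"
  by (simp add: K_map_def)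

section \<open>The equivalence over a universe\<close>

locale universe =
  fixes small :: "'u set \<Rightarrow> bool" and enc :: "'u set \<Rightarrow> 'u"
  assumes set_universe: "set_universe small enc"
begin

lemma small_subset: "\<lbrakk>small A; B \<subseteq> A\<rbrakk> \<Longrightarrow> small B"
  and small_image: "small A \<Longrightarrow> small ((h :: 'u \<Rightarrow> 'u) ` A)"
  and inj_enc: "inj_on enc {A. small A}"
  using set_universe by (auto simp: set_universe_def)

abbreviation prequantales where "prequantales \<equiv> PrecoherentPrequantales small"
abbreviation semilattices where "semilattices \<equiv> PrequanticSemilattices small"

sublocale P: omagma_cat "\<lambda>Q. precoherent_prequantale Q \<and> small (carrier (K Q))"
  precoherent_prequantale_morphism
  rewrites "P.cat = prequantales"
proof -
  show "omagma_cat (\<lambda>Q. precoherent_prequantale Q \<and> small (carrier (K Q)))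
      precoherent_prequantale_morphism"
  proof (rule omagma_cat.intro)
    show "f x \<in> carrier B" if "precoherent_prequantale_morphism A B f" "x \<in> carrier A" for A B f x
      using that by (auto simp: precoherent_prequantale_morphism_def prequantale_morphism_def magma_hom_def)
  qed (simp_all add: precoherent_prequantale_def precoherent_def
      omagma_iso_precoherent_prequantale_morphism precoherent_prequantale_morphism_compose)
qed (simp add: PrecoherentPrequantales_def)

sublocale S: omagma_cat "\<lambda>M. prequantic_semilattice M \<and> small (carrier M)"
  prequantic_semilattice_morphism
  rewrites "S.cat = semilattices"
proof -
  show "omagma_cat (\<lambda>M. prequantic_semilattice M \<and> small (carrier M))
      prequantic_semilattice_morphism"
  proof (rule omagma_cat.intro)
    show "f x \<in> carrier B" if "prequantic_semilattice_morphism A B f" "x \<in> carrier A" for A B f x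
      using that by (auto simp: prequantic_semilattice_morphism_def magma_hom_def)
  qed (simp_all add: prequantic_semilattice.axioms(1)
      omagma_iso_prequantic_semilattice_morphism prequantic_semilattice_morphism_compose)
qed (simp add: PrequanticSemilattices_def)

text \<open>Each single ideal is a subset of the small carrier and hence small; the set of all
  ideals is not asked to be small.\<close>

lemma inj_enc_ideals:
  assumes "small (carrier M)"
  shows "inj_on enc (ideals M)"
  by (rule inj_on_subset[OF inj_enc]) (use assms small_subset ideal_subset[of _ M] in auto)

abbreviation dec :: "'u omagma \<Rightarrow> 'u \<Rightarrow> 'u set" where
  "dec M \<equiv> inv_into (ideals M) enc"

lemma Idl_obj_simps [simp]:
  "carrier (Idl_obj enc M) = enc ` ideals M" "eq (Idl_obj enc M) = (=)"
  by (simp_all add: Idl_obj_def Let_def)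

text \<open>Order and product of \<open>Idl_obj enc M\<close> are defined by decoding, so
  injectivity of \<open>enc\<close> on ideals is the whole content.\<close>

lemma omagma_iso_enc:
  assumes M: "prequantic_semilattice M" and "small (carrier M)"
  shows "omagma_iso (Idl M) (Idl_obj enc M) enc"
  using inj_enc_ideals[OF assms(2)] by (simp add: omagma_iso_def Idl_obj_def Let_def bij_betw_def)

lemma precoherent_prequantale_Idl_obj:
  assumes M: "prequantic_semilattice M" "small (carrier M)"
  shows "precoherent_prequantale (Idl_obj enc M)"
proof (rule omagma_iso_precoherent_prequantale[OF _ omagma_iso_enc[OF M]])
  show "precoherent_prequantale (Idl M)"
    using M(1) by (rule prequantic_semilattice.precoherent_prequantale_Idl)
qed simp

abbreviation enc_principal :: "'u omagma \<Rightarrow> 'u \<Rightarrow> 'u" where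
  "enc_principal M \<equiv> enc \<circ> K_Idl_unit M"

lemma omagma_iso_enc_principal:
  assumes M: "prequantic_semilattice M" "small (carrier M)"
  shows "omagma_iso M (K (Idl_obj enc M)) (enc_principal M)"
proof (rule omagma_iso_comp[OF prequantic_semilattice.omagma_iso_K_Idl_unit[OF M(1)] omagma_iso_K])
  show "ordered_magma (Idl M)"
    using M(1) by (rule prequantic_semilattice.ordered_magma_Idl)
  show "ordered_magma (Idl_obj enc M)"
    by (rule precoherent_prequantale_magma[OF precoherent_prequantale_Idl_obj[OF M]])
  show "omagma_iso (Idl M) (Idl_obj enc M) enc"
    by (rule omagma_iso_enc[OF M])
qed

text \<open>The compact elements of the encoded ideals are the codes of principal ideals, an image
  of \<open>carrier M\<close> under a map from \<open>'u\<close> to \<open>'u\<close>. Closure of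
  the small sets under such images is what this calls for.\<close>

lemma ob_Idl_obj:
  assumes M: "prequantic_semilattice M" "small (carrier M)"
  shows "precoherent_prequantale (Idl_obj enc M) \<and> small (carrier (K (Idl_obj enc M)))"
proof -
  have "carrier (K (Idl_obj enc M)) = enc_principal M ` carrier M"
    using omagma_iso_enc_principal[OF M] unfolding omagma_iso_def bij_betw_def by blast
  then show ?thesis
    using precoherent_prequantale_Idl_obj[OF M] small_image[OF M(2)] by metis
qed

section \<open>The two functors over the universe\<close>

lemma cat_functor_K: "cat_functor prequantales semilattices K K_arr"
proof (intro cat_functor.intro cat_functor_axioms.intro P.category S.category)
  show "K A \<in> obj semilattices" if "A \<in> obj prequantales" for A
    using that
    by (simp add: PrecoherentPrequantales_def PrequanticSemilattices_def K_prequantic_semilattice)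
  show "K_arr f \<in> arr semilattices \<and> src semilattices (K_arr f) = K (src prequantales f) \<and>
      tgt semilattices (K_arr f) = K (tgt prequantales f)" if "f \<in> arr prequantales" for f
    using that unfolding PrecoherentPrequantales_def PrequanticSemilattices_def
    by (auto elim!: concrete_cat_arrE simp: K_arr_def K_prequantic_semilattice K_map_extensional
        intro: prequantic_semilattice_morphism_K_map)
  show "K_arr (ide prequantales A) = ide semilattices (K A)" for A
    by (simp add: K_arr_def K_map_id PrecoherentPrequantales_def PrequanticSemilattices_def del: K_simps)
  show "K_arr (cmp prequantales g f) = cmp semilattices (K_arr g) (K_arr f)"
    if "f \<in> arr prequantales" "g \<in> arr prequantales" "tgt prequantales f = src prequantales g" for f g
    using that unfolding PrecoherentPrequantales_def PrequanticSemilattices_def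
    by (auto elim!: concrete_cat_arrE simp: K_arr_def K_map_compose simp del: K_simps)
qed

abbreviation Idl_obj_map :: "'u omagma \<Rightarrow> 'u omagma \<Rightarrow> ('u \<Rightarrow> 'u) \<Rightarrow> 'u \<Rightarrow> 'u" where
  "Idl_obj_map M M' g \<equiv> \<lambda>x\<in>enc ` ideals M. enc (Idl_map M M' g (dec M x))"

lemma Idl_arr_apply: "Idl_arr enc (M, g, M') = (Idl_obj enc M, Idl_obj_map M M' g, Idl_obj enc M')"
  by (simp add: Idl_arr_def)

lemma dec_enc: "\<lbrakk>small (carrier M); I \<in> ideals M\<rbrakk> \<Longrightarrow> dec M (enc I) = I"
  by (simp add: inj_enc_ideals)

lemma Idl_obj_map_enc:
  "\<lbrakk>small (carrier M); I \<in> ideals M\<rbrakk> \<Longrightarrow> Idl_obj_map M M' g (enc I) = enc (Idl_map M M' g I)"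
  by (simp add: dec_enc)

text \<open>The map factors as decoding, \<open>Idl_map M M' g\<close> and encoding; the outer two
  are isomorphisms and all three are morphisms.\<close>

lemma precoherent_prequantale_morphism_Idl_obj_map:
  assumes M: "prequantic_semilattice M" "small (carrier M)"
    and M': "prequantic_semilattice M'" "small (carrier M')"
    and g: "prequantic_semilattice_morphism M M' g"
  shows "precoherent_prequantale_morphism (Idl_obj enc M) (Idl_obj enc M') (Idl_obj_map M M' g)"
proof -
  interpret g: prequantic_semilattice_hom M M' g
    using g by (rule prequantic_semilattice_homI)
  note E = omagma_iso_enc[OF M] and E' = omagma_iso_enc[OF M']
  have D: "precoherent_prequantale_morphism (Idl_obj enc M) (Idl M) (dec M)"
    using omagma_iso_precoherent_prequantale_morphism[OF precoherent_prequantale_Idl_obj[OF M]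
        g.M.precoherent_prequantale_Idl omagma_iso_inv[OF g.M.ordered_magma_Idl E]] by simp
  have E'': "precoherent_prequantale_morphism (Idl M') (Idl_obj enc M') enc"
    by (rule omagma_iso_precoherent_prequantale_morphism[OF g.M'.precoherent_prequantale_Idl
        precoherent_prequantale_Idl_obj[OF M'] E'])
  have "compose (carrier (Idl_obj enc M)) (compose (carrier (Idl M)) enc (Idl_map M M' g)) (dec M)
      = Idl_obj_map M M' g"
    by (auto simp: compose_def fun_eq_iff inv_into_into)
  then show ?thesis
    using precoherent_prequantale_morphism_compose[OF D precoherent_prequantale_morphism_compose[OF
          g.precoherent_prequantale_morphism_Idl_map E'']] by simp
qed

lemma cat_functor_Idl: "cat_functor semilattices prequantales (Idl_obj enc) (Idl_arr enc)"
proof (intro cat_functor.intro cat_functor_axioms.intro P.category S.category)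
  show "Idl_obj enc A \<in> obj prequantales" if "A \<in> obj semilattices" for A
    using that ob_Idl_obj by (simp add: PrecoherentPrequantales_def PrequanticSemilattices_def)
  show "Idl_arr enc f \<in> arr prequantales \<and>
      src prequantales (Idl_arr enc f) = Idl_obj enc (src semilattices f) \<and>
      tgt prequantales (Idl_arr enc f) = Idl_obj enc (tgt semilattices f)"
    if "f \<in> arr semilattices" for f
    using that ob_Idl_obj precoherent_prequantale_morphism_Idl_obj_map
    unfolding PrecoherentPrequantales_def PrequanticSemilattices_def
    by (auto elim!: concrete_cat_arrE simp: Idl_arr_apply simp del: K_simps)
  show "Idl_arr enc (ide semilattices A) = ide prequantales (Idl_obj enc A)"
    if "A \<in> obj semilattices" for A
  proof -
    have "prequantic_semilattice A"
      using that by (simp add: PrequanticSemilattices_def)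
    note id = Idl_map_id[OF this]
    show ?thesis
      by (auto simp: PrecoherentPrequantales_def PrequanticSemilattices_def Idl_arr_apply id
          inv_into_into f_inv_into_f fun_eq_iff)
  qed
  show "Idl_arr enc (cmp semilattices b a) = cmp prequantales (Idl_arr enc b) (Idl_arr enc a)"
    if ab: "a \<in> arr semilattices" "b \<in> arr semilattices" "tgt semilattices a = src semilattices b" for a b
  proof -
    obtain M g M' where a: "a = (M, g, M')" "prequantic_semilattice_morphism M M' g" "small (carrier M)"
      using ab(1) unfolding PrequanticSemilattices_def by (elim concrete_cat_arrE) blast
    obtain N g' M'' where b: "b = (N, g', M'')" "prequantic_semilattice_morphism N M'' g'" "small (carrier N)"
      using ab(2) unfolding PrequanticSemilattices_def by (elim concrete_cat_arrE) blast
    have N: "N = M'"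
      using ab(3) a b by (simp add: PrequanticSemilattices_def)
    interpret g: prequantic_semilattice_hom M M' g
      using a(2) by (rule prequantic_semilattice_homI)
    \<comment> \<open>In the middle, encoding followed by decoding cancels because
      \<open>Idl_map M M' g I\<close> is an ideal of the small \<open>M'\<close>.\<close>
    have "Idl_obj_map M M'' (compose (carrier M) g' g) (enc I)
        = Idl_obj_map M' M'' g' (Idl_obj_map M M' g (enc I))" if I: "I \<in> ideals M" for I
      using I g.Idl_map_ideal[OF I] a(3) b(3) N
      by (simp add: dec_enc Idl_map_compose[OF a(2) b(2)[unfolded N]] compose_eq)
    then have "Idl_obj_map M M'' (compose (carrier M) g' g)
        = compose (enc ` ideals M) (Idl_obj_map M' M'' g') (Idl_obj_map M M' g)"
      by (auto simp: compose_def fun_eq_iff)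
    then show ?thesis
      by (simp add: a b N Idl_arr_apply PrecoherentPrequantales_def PrequanticSemilattices_def)
  qed
qed

section \<open>The two natural isomorphisms over the universe\<close>

lemma natural_iso_Idl_K:
  "natural_iso prequantales prequantales (\<lambda>A. A) (\<lambda>f. f) (Idl_obj enc \<circ> K) (Idl_arr enc \<circ> K_arr)
    (\<lambda>Q. (Q, \<lambda>x\<in>carrier Q. enc (Idl_K_unit Q x), Idl_obj enc (K Q)))"
proof (intro natural_iso.intro natural_iso_axioms.intro cat_functor_id P.category
    cat_functor_comp[OF cat_functor_K cat_functor_Idl])
  fix Q assume "Q \<in> obj prequantales"
  then have Q: "precoherent_prequantale Q" "small (carrier (K Q))"
    by (simp_all add: PrecoherentPrequantales_def)
  let ?e = "\<lambda>x\<in>carrier Q. enc (Idl_K_unit Q x)"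
  note KQ = K_prequantic_semilattice[OF Q(1)]
  \<comment> \<open>The component is the unit into \<open>Idl (K Q)\<close> followed by encoding,
    which is available because \<open>K Q\<close> is small.\<close>
  have "omagma_iso Q (Idl_obj enc (K Q)) (enc \<circ> Idl_K_unit Q)"
    using omagma_iso_comp[OF _ omagma_iso_enc[OF KQ Q(2)]] Q(1)
      precoherent_prequantale_loc.omagma_iso_Idl_K_unit[of Q]
    by (simp add: precoherent_prequantale_loc_iff)
  then have "omagma_iso Q (Idl_obj enc (K Q)) ?e"
    by (rule omagma_iso_cong[OF _ precoherent_prequantale_magma[OF Q(1)]]) simp
  then have "iso_arr prequantales (Q, ?e, Idl_obj enc (K Q))"
    using Q ob_Idl_obj[OF KQ Q(2)] by (intro P.iso_arr) auto
  then show "iso_arr prequantales (Q, ?e, Idl_obj enc (K Q)) \<and>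
      src prequantales (Q, ?e, Idl_obj enc (K Q)) = Q \<and>
      tgt prequantales (Q, ?e, Idl_obj enc (K Q)) = (Idl_obj enc \<circ> K) Q"
    by (simp add: PrecoherentPrequantales_def)
next
  fix a assume a: "a \<in> arr prequantales"
  obtain Q f Q' where f: "a = (Q, f, Q')" "precoherent_prequantale_morphism Q Q' f"
    "small (carrier (K Q))" "f \<in> extensional (carrier Q)"
    using a unfolding PrecoherentPrequantales_def by (elim concrete_cat_arrE) blast
  interpret Q: precoherent_prequantale_loc Q
    using f by (simp add: precoherent_prequantale_morphism_def precoherent_prequantale_loc_iff)
  have "enc (Idl_K_unit Q' (f x)) = Idl_obj_map (K Q) (K Q') (K_map Q f) (enc (Idl_K_unit Q x))"
    if x: "x \<in> carrier Q" for x
    using Idl_K_unit_natural[OF f(2) x] Idl_obj_map_enc[OF f(3) Q.below_ideal[OF x]]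
    by (simp add: Q.Idl_K_unit_apply[OF x])
  moreover have "f x \<in> carrier Q'" if "x \<in> carrier Q" for x
    using P.hom_closed[OF f(2) that] .
  ultimately have "compose (carrier Q) (\<lambda>x\<in>carrier Q'. enc (Idl_K_unit Q' x)) f
      = compose (carrier Q) (Idl_obj_map (K Q) (K Q') (K_map Q f)) (\<lambda>x\<in>carrier Q. enc (Idl_K_unit Q x))"
    unfolding compose_def by (intro restrict_ext) (simp add: restrict_apply' del: restrict_apply)
  then show "cmp prequantales
        ((\<lambda>Q. (Q, \<lambda>x\<in>carrier Q. enc (Idl_K_unit Q x), Idl_obj enc (K Q))) (tgt prequantales a)) a
      = cmp prequantales ((Idl_arr enc \<circ> K_arr) a)
        ((\<lambda>Q. (Q, \<lambda>x\<in>carrier Q. enc (Idl_K_unit Q x), Idl_obj enc (K Q))) (src prequantales a))"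
    by (simp add: f(1) PrecoherentPrequantales_def Idl_arr_apply K_arr_def)
qed

text \<open>An equivalence asks for a transformation from \<open>K \<circ> Idl_obj enc\<close> to
  the identity, whereas \<open>enc_principal\<close> points the other way; hence the
  inverse.\<close>

abbreviation counit_map :: "'u omagma \<Rightarrow> 'u \<Rightarrow> 'u" where
  "counit_map M \<equiv> \<lambda>x\<in>carrier (K (Idl_obj enc M)). inv_into (carrier M) (enc_principal M) x"

lemma natural_iso_K_Idl:
  "natural_iso semilattices semilattices (K \<circ> Idl_obj enc) (K_arr \<circ> Idl_arr enc) (\<lambda>A. A) (\<lambda>f. f)
    (\<lambda>M. (K (Idl_obj enc M), counit_map M, M))"
proof (intro natural_iso.intro natural_iso_axioms.intro cat_functor_id S.category
    cat_functor_comp[OF cat_functor_Idl cat_functor_K])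
  fix M assume "M \<in> obj semilattices"
  then have M: "prequantic_semilattice M" "small (carrier M)"
    by (simp_all add: PrequanticSemilattices_def)
  note P = ob_Idl_obj[OF M]
  have K: "prequantic_semilattice (K (Idl_obj enc M))"
    using P K_prequantic_semilattice by blast
  have Mm: "ordered_magma M" "ordered_magma (K (Idl_obj enc M))"
    using M(1) K by (simp_all add: prequantic_semilattice.axioms(1))
  have "omagma_iso (K (Idl_obj enc M)) M (counit_map M)"
    by (rule omagma_iso_cong[OF omagma_iso_inv[OF Mm(1) omagma_iso_enc_principal[OF M]] Mm(2)])
      (simp del: K_simps)
  then have "iso_arr semilattices (K (Idl_obj enc M), counit_map M, M)"
    using M K P by (intro S.iso_arr) auto
  then show "iso_arr semilattices (K (Idl_obj enc M), counit_map M, M) \<and>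
      src semilattices (K (Idl_obj enc M), counit_map M, M) = (K \<circ> Idl_obj enc) M \<and>
      tgt semilattices (K (Idl_obj enc M), counit_map M, M) = M"
    by (simp add: PrequanticSemilattices_def)
next
  fix a assume a: "a \<in> arr semilattices"
  obtain M g M' where g: "a = (M, g, M')" "prequantic_semilattice_morphism M M' g"
    "small (carrier M)" "small (carrier M')"
    using a unfolding PrequanticSemilattices_def by (elim concrete_cat_arrE) blast
  interpret g: prequantic_semilattice_hom M M' g
    using g(2) by (rule prequantic_semilattice_homI)
  let ?P = "K (Idl_obj enc M)" and ?P' = "K (Idl_obj enc M')"
  note E = omagma_iso_inv_apply[OF omagma_iso_enc_principal[OF g.M.prequantic_semilattice_axioms g(3)]]
  note E' = omagma_iso_inv_apply[OF omagma_iso_enc_principal[OF g.M'.prequantic_semilattice_axioms g(4)]]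
  have eq: "counit_map M' (K_map (Idl_obj enc M) (Idl_obj_map M M' g) x) = g (counit_map M x)"
    if x: "x \<in> carrier ?P" for x
  proof -
    \<comment> \<open>Every compact element is the code of a principal ideal. Written this way,
      naturality of the inverse reduces to \<open>g\<close> sending the principal ideal of
      \<open>y\<close> to that of \<open>g y\<close>.\<close>
    obtain y where y: "y \<in> carrier M" "x = enc_principal M y"
      using E(2,4)[OF x] by metis
    have gy: "g y \<in> carrier M'"
      by (rule g.hom_closed[OF y(1)])
    have "K_map (Idl_obj enc M) (Idl_obj_map M M' g) x = Idl_obj_map M M' g (enc (principal_of M y))"
      using x y by (simp add: K_map_apply g.M.K_Idl_unit_apply del: restrict_apply)
    also have "\<dots> = enc (Idl_map M M' g (principal_of M y))"
      by (rule Idl_obj_map_enc[OF g(3) g.M.principal_ideal[OF y(1)]])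
    also have "\<dots> = enc_principal M' (g y)"
      by (simp add: g.Idl_map_principal[OF y(1)] g.M'.K_Idl_unit_apply[OF gy])
    finally have "K_map (Idl_obj enc M) (Idl_obj_map M M' g) x = enc_principal M' (g y)" .
    then show ?thesis
      using E(1)[OF y(1)] E(3)[OF y(1)] E'(1)[OF gy] E'(3)[OF gy] y(2) by simp
  qed
  have "compose (carrier ?P) (counit_map M') (K_map (Idl_obj enc M) (Idl_obj_map M M' g))
      = compose (carrier ?P) g (counit_map M)"
    unfolding compose_def by (rule restrict_ext[OF eq])
  then show "cmp semilattices ((\<lambda>M. (K (Idl_obj enc M), counit_map M, M)) (tgt semilattices a))
        ((K_arr \<circ> Idl_arr enc) a)
      = cmp semilattices a ((\<lambda>M. (K (Idl_obj enc M), counit_map M, M)) (src semilattices a))"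
    by (simp add: g(1) PrequanticSemilattices_def Idl_arr_apply K_arr_def del: K_simps)
qed

lemma equivalence:
  "equivalence_of_categories prequantales semilattices K K_arr (Idl_obj enc) (Idl_arr enc)"
  unfolding equivalence_of_categories_def
  using cat_functor_K cat_functor_Idl natural_iso_Idl_K natural_iso_K_Idl by blast

end

theorem theorem6p18:
  fixes Q :: "'a omagma" and Q' :: "'b omagma" and Q'' :: "'c omagma"
    and f :: "'a \<Rightarrow> 'b" and f' :: "'b \<Rightarrow> 'c"
    and M :: "'d omagma" and M' :: "'e omagma" and M'' :: "'f omagma"
    and g :: "'d \<Rightarrow> 'e" and g' :: "'e \<Rightarrow> 'f"
    and small :: "'u set \<Rightarrow> bool" and enc :: "'u set \<Rightarrow> 'u"
  shows
    \<comment> \<open>(1)\<close>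
    "(precoherent_prequantale_morphism Q Q' f
        \<longrightarrow> prequantic_semilattice_morphism (K Q) (K Q') (K_map Q f)) \<and>
    \<comment> \<open>(2)\<close>
     (prequantic_semilattice_morphism M M' g
        \<longrightarrow> precoherent_prequantale_morphism (Idl M) (Idl M') (Idl_map M M' g)) \<and>
    \<comment> \<open>(3), functoriality\<close>
     (precoherent_prequantale Q
        \<longrightarrow> K_map Q (\<lambda>x\<in>carrier Q. x) = (\<lambda>x\<in>carrier (K Q). x)) \<and>
     (precoherent_prequantale_morphism Q Q' f \<and> precoherent_prequantale_morphism Q' Q'' f'
        \<longrightarrow> K_map Q (compose (carrier Q) f' f)
              = compose (carrier (K Q)) (K_map Q' f') (K_map Q f)) \<and>
     (prequantic_semilattice M
        \<longrightarrow> Idl_map M M (\<lambda>x\<in>carrier M. x) = (\<lambda>I\<in>carrier (Idl M). I)) \<and>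
     (prequantic_semilattice_morphism M M' g \<and> prequantic_semilattice_morphism M' M'' g'
        \<longrightarrow> Idl_map M M'' (compose (carrier M) g' g)
              = compose (carrier (Idl M)) (Idl_map M' M'' g') (Idl_map M M' g)) \<and>
    \<comment> \<open>(3), natural isomorphisms of \<open>Idl \<circ> K\<close> and \<open>K \<circ> Idl\<close> with the identities, across all types\<close>
     (precoherent_prequantale Q
        \<longrightarrow> precoherent_prequantale_iso Q (Idl (K Q)) (Idl_K_unit Q)) \<and>
     (precoherent_prequantale_morphism Q Q' f
        \<longrightarrow> (\<forall>x\<in>carrier Q.
              Idl_K_unit Q' (f x) = Idl_map (K Q) (K Q') (K_map Q f) (Idl_K_unit Q x))) \<and>
     (prequantic_semilattice M
        \<longrightarrow> prequantic_semilattice_iso M (K (Idl M)) (K_Idl_unit M)) \<and>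
     (prequantic_semilattice_morphism M M' g
        \<longrightarrow> (\<forall>x\<in>carrier M.
              K_Idl_unit M' (g x) = K_map (Idl M) (Idl_map M M' g) (K_Idl_unit M x))) \<and>
    \<comment> \<open>(3), equivalence of categories over any universe\<close>
     (set_universe small enc
        \<longrightarrow> equivalence_of_categories (PrecoherentPrequantales small) (PrequanticSemilattices small)
              K K_arr (Idl_obj enc) (Idl_arr enc))"
proof (intro conjI impI ballI)
  assume f: "precoherent_prequantale_morphism Q Q' f"
  show "prequantic_semilattice_morphism (K Q) (K Q') (K_map Q f)"
    using f by (rule prequantic_semilattice_morphism_K_map)
  show "Idl_K_unit Q' (f x) = Idl_map (K Q) (K Q') (K_map Q f) (Idl_K_unit Q x)"
    if "x \<in> carrier Q" for x
    using f that by (rule Idl_K_unit_natural)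
next
  assume g: "prequantic_semilattice_morphism M M' g"
  then interpret prequantic_semilattice_hom M M' g
    by (rule prequantic_semilattice_homI)
  show "precoherent_prequantale_morphism (Idl M) (Idl M') (Idl_map M M' g)"
    by (rule precoherent_prequantale_morphism_Idl_map)
  show "K_Idl_unit M' (g x) = K_map (Idl M) (Idl_map M M' g) (K_Idl_unit M x)"
    if "x \<in> carrier M" for x
    using that by (rule K_Idl_unit_natural)
next
  show "K_map Q (\<lambda>x\<in>carrier Q. x) = (\<lambda>x\<in>carrier (K Q). x)"
    by (rule K_map_id)
next
  assume "precoherent_prequantale_morphism Q Q' f \<and> precoherent_prequantale_morphism Q' Q'' f'"
  then show "K_map Q (compose (carrier Q) f' f) = compose (carrier (K Q)) (K_map Q' f') (K_map Q f)"
    by (intro K_map_compose) simp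
next
  assume "prequantic_semilattice M"
  then show "Idl_map M M (\<lambda>x\<in>carrier M. x) = (\<lambda>I\<in>carrier (Idl M). I)"
    by (rule Idl_map_id)
next
  assume "prequantic_semilattice_morphism M M' g \<and> prequantic_semilattice_morphism M' M'' g'"
  then show "Idl_map M M'' (compose (carrier M) g' g)
      = compose (carrier (Idl M)) (Idl_map M' M'' g') (Idl_map M M' g)"
    by (intro Idl_map_compose) simp_all
next
  assume Q: "precoherent_prequantale Q"
  then interpret precoherent_prequantale_loc Q
    by (simp add: precoherent_prequantale_loc_iff)
  show "precoherent_prequantale_iso Q (Idl (K Q)) (Idl_K_unit Q)"
    by (rule omagma_iso_precoherent_prequantale_iso[OF Q _ omagma_iso_Idl_K_unit])
      (rule prequantic_semilattice.precoherent_prequantale_Idl[OF prequantic_semilattice_K])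
next
  assume M: "prequantic_semilattice M"
  then interpret prequantic_semilattice M .
  show "prequantic_semilattice_iso M (K (Idl M)) (K_Idl_unit M)"
    by (rule omagma_iso_prequantic_semilattice_iso[OF M prequantic_semilattice_K_Idl
          omagma_iso_K_Idl_unit])
next
  assume "set_universe small enc"
  then interpret universe small enc
    by (rule universe.intro)
  show "equivalence_of_categories (PrecoherentPrequantales small) (PrequanticSemilattices small)
      K K_arr (Idl_obj enc) (Idl_arr enc)"
    by (rule equivalence)
qed

end
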